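(* Let $(X,\rho,\mu)$ be a space of homogeneous type, let $1<p<\infty$, and let $w\in RH_p$ be a doubling weight on $X$. Then there exists $\epsilon>0$ such that $w\in RH_{p+\epsilon}$.
   Context: A quasi-metric space $(X,\rho)$ is a set $X$ with $\rho:X\times X\to[0,\infty)$ satisfying all axioms of a metric except the triangle inequality, in place of which there is a constant $\kappa_0>0$ with $\rho(x,y)\le\kappa_0(\rho(x,z)+\rho(z,y))$ for all $x,y,z\in X$. Open balls are $B(x,r)=\{y\in X:\rho(x,y)<r\}$. A space of homogeneous type $(X,\rho,\mu)$ is a quasi-metric space with a measure $\mu$ whose $\sigma$-algebra contains the Borel sets and all open $\rho$-balls, such that $0<\mu(B(x,r))<\infty$ for all $x\in X$, $r>0$, and such that there is a constant $\kappa_1>0$ with $\mu(B(x,2r))\le\kappa_1\mu(B(x,r))$ for all balls. A weight is a nonnegative locally integrable function on $X$ (integrable on every ball). For $1<q<\infty$, a weight $w$ belongs to the (continuous) reverse Hölder class $RH_q$ if there is a constant $C$ such that $\left(\frac{1}{\mu(B)}\int_Bw^q\,d\mu\right)^{1/q}\le C\frac{1}{\mu(B)}\int_Bw\,d\mu$ for all open balls $B$. Write $w(E)=\int_Ew\,d\mu$ and, for $B=B(x,r)$, $2B=B(x,2r)$. The weight $w$ is doubling if there is a constant $C$ with $w(2B)\le Cw(B)$ for all balls $B$.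
   Formalization: The formal theorem additionally assumes that every measurable set of finite measure agrees with a Borel set up to a null set; without this (for σ-algebras essentially larger than the Borel one) the claim is false. *)

theory Defs
  imports "HOL-Analysis.Analysis"
begin

locale quasi_metric_space =
  fixes X :: "'a set" and \<rho> :: "'a \<Rightarrow> 'a \<Rightarrow> real"
  assumes nonneg: "\<And>x y. x \<in> X \<Longrightarrow> y \<in> X \<Longrightarrow> 0 \<le> \<rho> x y"
    and zero_iff: "\<And>x y. x \<in> X \<Longrightarrow> y \<in> X \<Longrightarrow> \<rho> x y = 0 \<longleftrightarrow> x = y"
    and commute: "\<And>x y. x \<in> X \<Longrightarrow> y \<in> X \<Longrightarrow> \<rho> x y = \<rho> y x"
    and quasi_triangle: "\<exists>\<kappa>\<^sub>0>0. \<forall>x\<in>X. \<forall>y\<in>X. \<forall>z\<in>X. \<rho> x y \<le> \<kappa>\<^sub>0 * (\<rho> x z + \<rho> z y)"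

definition qball :: "'a set \<Rightarrow> ('a \<Rightarrow> 'a \<Rightarrow> real) \<Rightarrow> 'a \<Rightarrow> real \<Rightarrow> 'a set" where
  "qball X \<rho> x r = {y \<in> X. \<rho> x y < r}"

text \<open>The topology of a quasi-metric space: a set is open if it contains a ball around each
  of its points. The balls themselves need not be open, nor even Borel.\<close>

definition qopen :: "'a set \<Rightarrow> ('a \<Rightarrow> 'a \<Rightarrow> real) \<Rightarrow> 'a set \<Rightarrow> bool" where
  "qopen X \<rho> U \<longleftrightarrow> U \<subseteq> X \<and> (\<forall>x\<in>U. \<exists>r>0. qball X \<rho> x r \<subseteq> U)"

definition qborel_sets :: "'a set \<Rightarrow> ('a \<Rightarrow> 'a \<Rightarrow> real) \<Rightarrow> 'a set set" where
  "qborel_sets X \<rho> = sigma_sets X {U. qopen X \<rho> U}"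

locale homogeneous_type_space = quasi_metric_space "space M" \<rho>
  for M :: "'a measure" and \<rho> :: "'a \<Rightarrow> 'a \<Rightarrow> real" +
  assumes borel_measurable_sets: "qborel_sets (space M) \<rho> \<subseteq> sets M"
    and qball_measurable: "\<And>x r. x \<in> space M \<Longrightarrow> r > 0 \<Longrightarrow> qball (space M) \<rho> x r \<in> sets M"
    and qball_pos: "\<And>x r. x \<in> space M \<Longrightarrow> r > 0 \<Longrightarrow> 0 < emeasure M (qball (space M) \<rho> x r)"
    and qball_finite: "\<And>x r. x \<in> space M \<Longrightarrow> r > 0 \<Longrightarrow> emeasure M (qball (space M) \<rho> x r) < \<infinity>"
    and doubling: "\<exists>\<kappa>\<^sub>1>0. \<forall>x\<in>space M. \<forall>r>0.
      measure M (qball (space M) \<rho> x (2 * r)) \<le> \<kappa>\<^sub>1 * measure M (qball (space M) \<rho> x r)"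

text \<open>Borel semi-regularity: measurable sets of finite measure are Borel up to null sets.
  It holds automatically if the \<open>\<sigma>\<close>-algebra is the Borel one or its completion. For a larger
  \<open>\<sigma>\<close>-algebra the Lebesgue differentiation theorem, and with it the self-improvement of
  reverse Hoelder inequalities, can fail: let \<open>\<phi> : [0,1] \<rightarrow> [0,1]\<close> have a graph of full outer
  measure in the unit square, pull the Borel sets of the square and its area back
  along \<open>x \<mapsto> (x, \<phi> x)\<close>, and take \<open>w = g \<circ> \<phi>\<close> with \<open>g\<close> in \<open>L^p\<close> but in no \<open>L^q\<close> with
  \<open>q > p\<close>. The averages of \<open>w\<close> and of \<open>w^p\<close> then do not depend on the ball.\<close>

definition borel_semiregular :: "'a measure \<Rightarrow> ('a \<Rightarrow> 'a \<Rightarrow> real) \<Rightarrow> bool" where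
  "borel_semiregular M \<rho> \<longleftrightarrow>
     (\<forall>A\<in>sets M. emeasure M A < \<infinity> \<longrightarrow>
        (\<exists>E\<in>qborel_sets (space M) \<rho>. emeasure M ((A - E) \<union> (E - A)) = 0))"

definition weight :: "'a measure \<Rightarrow> ('a \<Rightarrow> 'a \<Rightarrow> real) \<Rightarrow> ('a \<Rightarrow> real) \<Rightarrow> bool" where
  "weight M \<rho> w \<longleftrightarrow>
     (\<forall>x\<in>space M. 0 \<le> w x) \<and>
     (\<forall>x\<in>space M. \<forall>r>0. set_integrable M (qball (space M) \<rho> x r) w)"

definition doubling_weight :: "'a measure \<Rightarrow> ('a \<Rightarrow> 'a \<Rightarrow> real) \<Rightarrow> ('a \<Rightarrow> real) \<Rightarrow> bool" where
  "doubling_weight M \<rho> w \<longleftrightarrow>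
     weight M \<rho> w \<and>
     (\<exists>C. \<forall>x\<in>space M. \<forall>r>0.
        (LINT y : qball (space M) \<rho> x (2 * r) | M. w y)
          \<le> C * (LINT y : qball (space M) \<rho> x r | M. w y))"

text \<open>The integrability conjunct says that the left-hand side of the inequality is finite;
  without it, a divergent integral of \<open>w powr q\<close> would count as \<open>0\<close>.\<close>

definition reverse_hoelder_class ::
  "'a measure \<Rightarrow> ('a \<Rightarrow> 'a \<Rightarrow> real) \<Rightarrow> real \<Rightarrow> ('a \<Rightarrow> real) set" where
  "reverse_hoelder_class M \<rho> q = {w. weight M \<rho> w \<and>
     (\<exists>C. \<forall>x\<in>space M. \<forall>r>0. let B = qball (space M) \<rho> x r in
        set_integrable M B (\<lambda>y. w y powr q) \<and>
        (1 / measure M B * (LINT y : B | M. w y powr q)) powr (1 / q)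
          \<le> C * (1 / measure M B * (LINT y : B | M. w y)))}"

end

theory Submission
  imports Defs
begin

text \<open>
  This is Gehring's lemma. Let \<open>\<nu>\<close> and \<open>\<sigma>\<close> be the measures with densities \<open>w\<close> and \<open>w\<^sup>p\<close>, and let
  \<open>a(B) = \<nu>(B) / \<mu>(B)\<close> be the mean of \<open>w\<close> over a ball \<open>B\<close>. What has to be shown is that \<open>\<sigma>\<close> charges
  high superlevel sets of \<open>w\<close> very little: for some \<open>L\<close>, every ball \<open>B\<close> and every \<open>m\<close>,
  \<open>\<sigma>{y \<in> B. L\<^sup>m a(B) < w y} \<le> 2\<^sup>-\<^sup>m \<sigma>(B)\<close> (lemma \<open>superlevel_decay\<close>). If \<open>L\<^sup>\<epsilon> = 3/2\<close>, the
  integral of \<open>w\<^sup>\<epsilon>\<close> over \<open>B\<close> against \<open>\<sigma>\<close> is then dominated by a geometric series of ratio \<open>3/4\<close>, so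
  it is at most a constant times \<open>a(B)\<^sup>\<epsilon> \<sigma>(B)\<close>, and the given reverse Hoelder inequality bounds
  \<open>\<sigma>(B)\<close> by a constant times \<open>\<mu>(B) a(B)\<^sup>p\<close> (lemma \<open>higher_integrability\<close>).

  The decay is proved by induction on \<open>m\<close>, simultaneously for all balls. The step is lemma
  \<open>halving_cover\<close>: up to a null set, \<open>{y \<in> B. L a(B) < w y}\<close> is covered by countably many balls
  whose means are at most \<open>L a(B)\<close> and whose \<open>\<sigma>\<close>-masses add up to at most \<open>\<sigma>(B)/2\<close>. On such a
  ball \<open>B'\<close> the inequality \<open>w y > L\<^sup>m\<^sup>+\<^sup>1 a(B)\<close> implies \<open>w y > L\<^sup>m a(B')\<close>, and the induction
  hypothesis for \<open>B'\<close> applies, even where \<open>B'\<close> sticks out of \<open>B\<close>. So the dilations that a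
  covering argument introduces do not accumulate.

  For the covering, fix a level \<open>l\<close> above a multiple of \<open>a(B)\<close>. A stopping argument and Vitali's
  lemma give disjoint balls \<open>B\<^sub>i\<close> of mean above \<open>l\<close> whose dilates have mean at most \<open>l\<close> and cover
  the points of \<open>B\<close> around which some small ball has mean above \<open>l\<close>. By the reverse Hoelder
  inequality and doubling, the dilate of \<open>B\<^sub>i\<close> has \<open>\<sigma>\<close>-mass at most a constant times
  \<open>l\<^sup>p \<mu>(B\<^sub>i)\<close>; since the mean over \<open>B\<^sub>i\<close> exceeds \<open>l\<close>, this is at most a constant times
  \<open>l\<^sup>p\<^sup>-\<^sup>1 \<nu>(B\<^sub>i \<inter> {w > l/2})\<close>. Summed over \<open>i\<close> and then over dyadic levels \<open>l\<close>, these bounds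
  add up to a constant times \<open>\<sigma>(B)\<close>. Hence among sufficiently many consecutive dyadic levels
  there is one whose stopping balls have total mass at most \<open>\<sigma>(B)/2\<close>.

  That almost every point with \<open>w > 2l\<close> is the centre of small balls of mean above \<open>l\<close> is a
  one-sided Lebesgue differentiation theorem (lemma \<open>exceeding_small_averages_null\<close>). It follows
  from outer regularity of finite Borel measures, which semi-regularity makes available for the
  superlevel sets of \<open>w\<close>, and again Vitali's lemma.
\<close>

section \<open>Balls in quasi-metric spaces and Vitali's covering lemma\<close>

text \<open>A fixed quasi-metric constant; taking it at least \<open>1\<close> makes dilations by it enlarge balls.\<close>
locale quasi_metric_constant = quasi_metric_space +
  fixes \<kappa> :: real
  assumes one_le_constant: "1 \<le> \<kappa>"
    and triangle: "\<And>x y z. x \<in> X \<Longrightarrow> y \<in> X \<Longrightarrow> z \<in> X \<Longrightarrow> \<rho> x y \<le> \<kappa> * (\<rho> x z + \<rho> z y)"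
begin

lemma triangle_less:
  assumes "x \<in> X" "y \<in> X" "z \<in> X" "\<rho> x z < r" "\<rho> z y < s"
  shows "\<rho> x y < \<kappa> * (r + s)"
proof -
  have "\<rho> x y \<le> \<kappa> * (\<rho> x z + \<rho> z y)" using triangle assms by blast
  also have "\<dots> < \<kappa> * (r + s)"
    using assms one_le_constant by (intro mult_strict_left_mono) auto
  finally show ?thesis .
qed

lemma centre_in_qball: "x \<in> X \<Longrightarrow> 0 < r \<Longrightarrow> x \<in> qball X \<rho> x r"
  using zero_iff[of x x] by (auto simp: qball_def)

lemma qball_subset_space: "qball X \<rho> x r \<subseteq> X"
  by (auto simp: qball_def)

lemma qball_mono: "r \<le> s \<Longrightarrow> qball X \<rho> x r \<subseteq> qball X \<rho> x s"
  by (auto simp: qball_def)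

lemma qball_subset_qball:
  assumes "x \<in> X" "y \<in> qball X \<rho> x r"
  shows "qball X \<rho> y s \<subseteq> qball X \<rho> x (\<kappa> * (r + s))"
  using assms triangle_less[of x _ y r s] by (auto simp: qball_def)

lemma intersecting_qballs:
  assumes "x \<in> X" "y \<in> X" "qball X \<rho> x r \<inter> qball X \<rho> y s \<noteq> {}"
  shows "\<rho> x y < \<kappa> * (r + s)"
proof -
  from assms(3) obtain z where "z \<in> X" "\<rho> x z < r" "\<rho> y z < s" by (auto simp: qball_def)
  then show ?thesis using triangle_less[of x y z r s] assms commute[of y z] by auto
qed

text \<open>A subfamily of disjoint balls is admissible if every ball that meets one of its members
  meets one of at least half its own radius. A maximal admissible subfamily meets every ball:
  otherwise one could add, among the balls it misses, one whose radius exceeds half of the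
  supremum. By admissibility and the quasi-triangle inequality, the centre of each ball is within
  \<open>\<kappa> (1 + 2)\<close> radii of a selected one. Only centres are covered, which suffices for sets of
  centres and keeps the dilation small.\<close>
lemma vitali_covering:
  assumes S: "S \<subseteq> X" and t: "\<And>y. y \<in> S \<Longrightarrow> 0 < t y \<and> t y \<le> R"
  obtains I where "I \<subseteq> S" "disjoint_family_on (\<lambda>i. qball X \<rho> i (t i)) I"
    "S \<subseteq> (\<Union>i\<in>I. qball X \<rho> i (3 * \<kappa> * t i))"
proof -
  define B where "B y = qball X \<rho> y (t y)" for y
  define \<A> where "\<A> = {I. I \<subseteq> S \<and> disjoint_family_on B I \<and>
    (\<forall>y\<in>S. (\<exists>i\<in>I. B y \<inter> B i \<noteq> {}) \<longrightarrow> (\<exists>i\<in>I. B y \<inter> B i \<noteq> {} \<and> t y \<le> 2 * t i))}"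
  have "\<exists>I\<in>\<A>. \<forall>J\<in>\<A>. I \<subseteq> J \<longrightarrow> J = I"
  proof (rule subset_Zorn_nonempty)
    have "{} \<in> \<A>" by (auto simp: \<A>_def disjoint_family_on_def)
    then show "\<A> \<noteq> {}" by blast
  next
    fix \<C> assume \<C>: "\<C> \<noteq> {}" "subset.chain \<A> \<C>"
    then have sub: "\<C> \<subseteq> \<A>" and ch: "\<And>I J. I \<in> \<C> \<Longrightarrow> J \<in> \<C> \<Longrightarrow> I \<subseteq> J \<or> J \<subseteq> I"
      by (auto simp: subset.chain_def subset_chain_def)
    have "disjoint_family_on B (\<Union>\<C>)"
      unfolding disjoint_family_on_def
    proof safe
      fix i j I J z assume "I \<in> \<C>" "J \<in> \<C>" "i \<in> I" "j \<in> J" "i \<noteq> j" and z: "z \<in> B i" "z \<in> B j"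
      then obtain H where "H \<in> \<C>" "i \<in> H" "j \<in> H" using ch[of I J] by blast
      moreover have "disjoint_family_on B H" using \<open>H \<in> \<C>\<close> sub by (auto simp: \<A>_def)
      ultimately show "z \<in> {}" using \<open>i \<noteq> j\<close> z unfolding disjoint_family_on_def by blast
    qed
    moreover have "\<Union>\<C> \<subseteq> S" using sub by (auto simp: \<A>_def)
    moreover have "\<exists>i\<in>\<Union>\<C>. B y \<inter> B i \<noteq> {} \<and> t y \<le> 2 * t i"
      if y: "y \<in> S" and ex: "\<exists>i\<in>\<Union>\<C>. B y \<inter> B i \<noteq> {}" for y
    proof -
      from ex obtain I where I: "I \<in> \<C>" "\<exists>i\<in>I. B y \<inter> B i \<noteq> {}" by blast
      then have "\<exists>i\<in>I. B y \<inter> B i \<noteq> {} \<and> t y \<le> 2 * t i"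
        using sub y unfolding \<A>_def by blast
      then show ?thesis using I(1) by blast
    qed
    ultimately show "\<Union>\<C> \<in> \<A>" unfolding \<A>_def by blast
  qed
  then obtain I where I: "I \<in> \<A>" and maximal: "\<And>J. J \<in> \<A> \<Longrightarrow> I \<subseteq> J \<Longrightarrow> J = I" by blast
  have IS: "I \<subseteq> S" and dI: "disjoint_family_on B I"
    and sel: "\<And>y. y \<in> S \<Longrightarrow> \<exists>i\<in>I. B y \<inter> B i \<noteq> {} \<Longrightarrow> \<exists>i\<in>I. B y \<inter> B i \<noteq> {} \<and> t y \<le> 2 * t i"
    using I by (auto simp: \<A>_def)
  define S' where "S' = {y \<in> S. \<forall>i\<in>I. B y \<inter> B i = {}}"
  have "S' = {}"
  proof (rule ccontr)
    assume ne: "S' \<noteq> {}"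
    have bdd: "bdd_above (t ` S')" using t by (auto simp: S'_def bdd_above_def)
    have pos: "0 < Sup (t ` S')"
    proof -
      obtain y where "y \<in> S'" using ne by blast
      then have "0 < t y" "t y \<le> Sup (t ` S')" using t bdd by (auto simp: S'_def intro: cSup_upper)
      then show ?thesis by simp
    qed
    then obtain y0 where y0: "y0 \<in> S'" "Sup (t ` S') / 2 < t y0"
      using less_cSup_iff[of "t ` S'" "Sup (t ` S') / 2"] ne bdd by auto
    have big: "t y \<le> 2 * t y0" if "y \<in> S'" for y
      using cSup_upper[OF _ bdd, of "t y"] that y0(2) by auto
    have "y0 \<in> B y0" using y0(1) t S centre_in_qball by (auto simp: B_def S'_def)
    then have "y0 \<notin> I" using y0(1) by (auto simp: S'_def)
    moreover have "insert y0 I \<in> \<A>"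
      unfolding \<A>_def
    proof (intro CollectI conjI ballI impI)
      show "insert y0 I \<subseteq> S" using IS y0 by (auto simp: S'_def)
      show "disjoint_family_on B (insert y0 I)"
        using dI y0(1) unfolding disjoint_family_on_def S'_def by auto
    next
      fix y assume y: "y \<in> S" "\<exists>i\<in>insert y0 I. B y \<inter> B i \<noteq> {}"
      show "\<exists>i\<in>insert y0 I. B y \<inter> B i \<noteq> {} \<and> t y \<le> 2 * t i"
      proof (cases "\<exists>i\<in>I. B y \<inter> B i \<noteq> {}")
        case True
        then show ?thesis using sel y by blast
      next
        case False
        then have "y \<in> S'" using y by (auto simp: S'_def)
        then show ?thesis using big y False by blast
      qed
    qed
    ultimately show False using maximal[of "insert y0 I"] by blast
  qed
  have "y \<in> (\<Union>i\<in>I. qball X \<rho> i (3 * \<kappa> * t i))" if y: "y \<in> S" for y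
  proof -
    have "\<exists>i\<in>I. B y \<inter> B i \<noteq> {}" using \<open>S' = {}\<close> y by (auto simp: S'_def)
    then obtain i where i: "i \<in> I" "B y \<inter> B i \<noteq> {}" "t y \<le> 2 * t i" using sel y by blast
    have "\<rho> i y < \<kappa> * (t i + t y)"
      using intersecting_qballs[of i y "t i" "t y"] i IS S y by (auto simp: B_def Int_commute)
    also have "\<dots> \<le> \<kappa> * (3 * t i)" using i(3) one_le_constant by (intro mult_left_mono) auto
    finally show ?thesis using i(1) y S by (auto simp: qball_def algebra_simps)
  qed
  then show ?thesis using that[OF IS] dI unfolding B_def by blast
qed

section \<open>Open neighbourhoods and regularity of finite Borel measures\<close>

text \<open>Balls need not be open, so open neighbourhoods are built by hand. The points reached from
  \<open>F\<close> by chains of \<open>n\<close> steps, of lengths below \<open>s\<close>, \<open>s/(2\<kappa>)\<close>, \<open>s/(2\<kappa>)\<^sup>2\<close>, and so on; the ratio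
  compensates the factor \<open>\<kappa>\<close> that each use of the quasi-triangle inequality costs.\<close>
primrec chain_neighbourhood :: "nat \<Rightarrow> real \<Rightarrow> 'a set \<Rightarrow> 'a set" where
  "chain_neighbourhood 0 s F = F"
| "chain_neighbourhood (Suc n) s F =
     chain_neighbourhood n (s / (2 * \<kappa>)) (\<Union>y\<in>F. qball X \<rho> y s)"

lemma chain_neighbourhood_close:
  assumes "F \<subseteq> X" "0 < s" "z \<in> chain_neighbourhood n s F"
  shows "z \<in> X \<and> (\<exists>y\<in>F. \<rho> y z < 2 * \<kappa> * s)"
  using assms
proof (induction n arbitrary: s F)
  case 0
  then show ?case using zero_iff[of z z] one_le_constant by (auto intro!: bexI[of _ z])
next
  case (Suc n)
  have k: "0 < \<kappa>" using one_le_constant by simp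
  have "z \<in> X \<and> (\<exists>y\<in>(\<Union>y\<in>F. qball X \<rho> y s). \<rho> y z < 2 * \<kappa> * (s / (2 * \<kappa>)))"
    using Suc.prems k by (intro Suc.IH) (auto simp: qball_def)
  then obtain y y' where "z \<in> X" "y \<in> F" "y' \<in> X" "\<rho> y y' < s" "\<rho> y' z < s"
    using k by (auto simp: qball_def)
  then show ?case using triangle_less[of y z y' s s] Suc.prems by (auto simp: algebra_simps)
qed

lemma qball_subset_chain_neighbourhood:
  assumes "z \<in> chain_neighbourhood n s F"
  shows "qball X \<rho> z (s / (2 * \<kappa>) ^ n) \<subseteq> chain_neighbourhood (Suc n) s F"
  using assms
proof (induction n arbitrary: s F)
  case 0
  then show ?case by auto
next
  case (Suc n)
  have "qball X \<rho> z (s / (2 * \<kappa>) / (2 * \<kappa>) ^ n)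
      \<subseteq> chain_neighbourhood (Suc n) (s / (2 * \<kappa>)) (\<Union>y\<in>F. qball X \<rho> y s)"
    using Suc.prems by (intro Suc.IH) simp
  then show ?case by (simp add: field_simps)
qed

text \<open>The union of all chain neighbourhoods is open because every chain can be prolonged by one
  more step.\<close>
lemma qopen_neighbourhood:
  assumes "F \<subseteq> X" "0 < e"
  obtains U where "qopen X \<rho> U" "F \<subseteq> U" "\<And>z. z \<in> U \<Longrightarrow> \<exists>y\<in>F. \<rho> y z < e"
proof -
  have k: "0 < \<kappa>" using one_le_constant by simp
  define s where "s = e / (2 * \<kappa>)"
  have s: "0 < s" "2 * \<kappa> * s = e" using k assms(2) by (auto simp: s_def)
  define U where "U = (\<Union>n. chain_neighbourhood n s F)"
  have close: "z \<in> X \<and> (\<exists>y\<in>F. \<rho> y z < e)" if "z \<in> U" for z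
    using chain_neighbourhood_close[OF assms(1) s(1)] s(2) that by (auto simp: U_def)
  have "qopen X \<rho> U"
    unfolding qopen_def
  proof (intro conjI ballI)
    show "U \<subseteq> X" using close by blast
    fix z assume "z \<in> U"
    then obtain n where "z \<in> chain_neighbourhood n s F" by (auto simp: U_def)
    then have "qball X \<rho> z (s / (2 * \<kappa>) ^ n) \<subseteq> U"
      using qball_subset_chain_neighbourhood by (fastforce simp: U_def simp del: chain_neighbourhood.simps)
    then show "\<exists>r>0. qball X \<rho> z r \<subseteq> U" using s k by (intro exI[of _ "s / (2 * \<kappa>) ^ n"]) auto
  qed
  moreover have "F \<subseteq> U" by (auto simp: U_def intro!: exI[of _ 0])
  ultimately show ?thesis using close that by blast
qed

end

lemma qopen_UN:
  assumes "\<And>i. i \<in> I \<Longrightarrow> qopen X \<rho> (U i)"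
  shows "qopen X \<rho> (\<Union>i\<in>I. U i)"
  unfolding qopen_def
proof (intro conjI ballI)
  show "(\<Union>i\<in>I. U i) \<subseteq> X" using assms by (auto simp: qopen_def)
  fix x assume "x \<in> (\<Union>i\<in>I. U i)"
  then obtain i where i: "i \<in> I" "x \<in> U i" by blast
  then obtain r where "r > 0" "qball X \<rho> x r \<subseteq> U i" using assms[OF i(1)] by (auto simp: qopen_def)
  then show "\<exists>r>0. qball X \<rho> x r \<subseteq> (\<Union>i\<in>I. U i)" using i(1) by blast
qed

lemma qopen_Int:
  assumes "qopen X \<rho> U" "qopen X \<rho> V"
  shows "qopen X \<rho> (U \<inter> V)"
  unfolding qopen_def
proof (intro conjI ballI)
  show "U \<inter> V \<subseteq> X" using assms by (auto simp: qopen_def)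
  fix x assume "x \<in> U \<inter> V"
  then obtain r s where "r > 0" "s > 0" "qball X \<rho> x r \<subseteq> U" "qball X \<rho> x s \<subseteq> V"
    using assms unfolding qopen_def by (meson IntD1 IntD2)
  then show "\<exists>r>0. qball X \<rho> x r \<subseteq> U \<inter> V"
    by (intro exI[of _ "min r s"]) (auto simp: qball_def)
qed

lemma qopen_finite_INT:
  fixes V :: "nat \<Rightarrow> 'a set"
  shows "(\<And>i. qopen X \<rho> (V i)) \<Longrightarrow> qopen X \<rho> (\<Inter>i\<le>n. V i)"
  by (induction n) (auto simp: atMost_Suc intro: qopen_Int)

context quasi_metric_constant
begin

text \<open>The sets \<open>A\<close> squeezed between an open \<open>U\<close> and the closed complement of an open \<open>V\<close>, with
  \<open>U \<inter> V\<close> of small measure, form a \<open>\<sigma>\<close>-algebra; stating both approximations at once makes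
  closure under complements a mere exchange of \<open>U\<close> and \<open>V\<close>. Open sets belong to it since a closed
  set is the intersection of its open neighbourhoods.\<close>
lemma borel_regularity:
  assumes N: "finite_measure N" "space N = X" "qborel_sets X \<rho> \<subseteq> sets N"
    and A: "A \<in> qborel_sets X \<rho>" and e: "0 < e"
  shows "\<exists>U V. qopen X \<rho> U \<and> qopen X \<rho> V \<and> A \<subseteq> U \<and> X - A \<subseteq> V \<and> measure N (U \<inter> V) < e"
proof -
  interpret finite_measure N by fact
  have opn: "U \<in> sets N" if "qopen X \<rho> U" for U
    using that N(3) by (auto simp: qborel_sets_def intro: sigma_sets.Basic)
  from A show ?thesis using e unfolding qborel_sets_def
  proof (induction arbitrary: e rule: sigma_sets.induct)
    case (Basic A)
    then have A: "qopen X \<rho> A" "A \<subseteq> X" by (auto simp: qopen_def)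
    have "\<forall>n. \<exists>V. qopen X \<rho> V \<and> X - A \<subseteq> V \<and> (\<forall>z\<in>V. \<exists>y\<in>X - A. \<rho> y z < inverse (Suc n))"
    proof
      fix n
      obtain V where "qopen X \<rho> V" "X - A \<subseteq> V" "\<And>z. z \<in> V \<Longrightarrow> \<exists>y\<in>X - A. \<rho> y z < inverse (Suc n)"
        using qopen_neighbourhood[of "X - A" "inverse (Suc n)"] by auto
      then show "\<exists>V. qopen X \<rho> V \<and> X - A \<subseteq> V \<and> (\<forall>z\<in>V. \<exists>y\<in>X - A. \<rho> y z < inverse (Suc n))" by blast
    qed
    then obtain V where V: "\<And>n. qopen X \<rho> (V n)" "\<And>n. X - A \<subseteq> V n"
      "\<And>n z. z \<in> V n \<Longrightarrow> \<exists>y\<in>X - A. \<rho> y z < inverse (Suc n)" by metis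
    define Q where "Q n = A \<inter> (\<Inter>i\<le>n. V i)" for n
    have "(\<Inter>n. Q n) = {}"
    proof (rule equals0I)
      fix z assume "z \<in> (\<Inter>n. Q n)"
      then have z: "z \<in> A" "\<And>n. z \<in> V n" by (auto simp: Q_def)
      from z(1) A(1) obtain r where r: "r > 0" "qball X \<rho> z r \<subseteq> A" by (auto simp: qopen_def)
      obtain n where "inverse (real (Suc n)) < r" using r(1) reals_Archimedean by blast
      then obtain y where "y \<in> X - A" "\<rho> y z < r" using V(3)[OF z(2), of n] by force
      moreover have "z \<in> X" using z(1) A(2) by blast
      ultimately have "y \<in> qball X \<rho> z r" using commute[of y z] by (simp add: qball_def)
      then show False using r(2) \<open>y \<in> X - A\<close> by blast
    qed
    moreover have "(\<lambda>n. measure N (Q n)) \<longlonglongrightarrow> measure N (\<Inter>n. Q n)"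
    proof (rule finite_Lim_measure_decseq)
      show "range Q \<subseteq> sets N" using qopen_finite_INT[of X \<rho> V] V(1) opn A(1)
        by (auto simp: Q_def)
      show "decseq Q" by (auto simp: Q_def decseq_def)
    qed
    ultimately have "(\<lambda>n. measure N (Q n)) \<longlonglongrightarrow> 0" by simp
    then have "eventually (\<lambda>n. measure N (Q n) < e) sequentially"
      using Basic.prems by (rule order_tendstoD)
    then obtain n where n: "measure N (Q n) < e" by (auto simp: eventually_sequentially)
    have "qopen X \<rho> (\<Inter>i\<le>n. V i)" using V(1) by (rule qopen_finite_INT)
    moreover have "X - A \<subseteq> (\<Inter>i\<le>n. V i)" using V(2) by blast
    ultimately show ?case
      using A(1) n unfolding Q_def by (intro exI[of _ A] exI[of _ "\<Inter>i\<le>n. V i"]) simp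
  next
    case Empty
    have "qopen X \<rho> {}" by (simp add: qopen_def)
    moreover have "qopen X \<rho> X" using qball_subset_space by (auto simp: qopen_def intro!: exI[of _ "1::real"])
    ultimately
    show ?case using Empty by (intro exI[of _ "{}"] exI[of _ X]) simp
  next
    case (Compl A)
    from Compl.IH[OF Compl.prems]
    obtain U V where UV: "qopen X \<rho> U" "qopen X \<rho> V" "A \<subseteq> U" "X - A \<subseteq> V" "measure N (U \<inter> V) < e"
      by blast
    have "{U. qopen X \<rho> U} \<subseteq> Pow X" by (auto simp: qopen_def)
    then have "A \<subseteq> X" using Compl.hyps sigma_sets_into_sp by blast
    then have "X - (X - A) \<subseteq> U" using UV(3) by (simp add: double_diff)
    moreover have "measure N (V \<inter> U) < e" using UV(5) by (simp add: Int_commute)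
    ultimately show ?case using UV(1,2,4) by (intro exI[of _ V] exI[of _ U]) simp
  next
    case (Union A)
    \<comment> \<open>The \<open>U i \<inter> V i\<close> use up \<open>e/2\<close>. The other half is for truncating the intersection of the
      \<open>V i\<close> to finitely many sets, as it has to be open.\<close>
    have "\<forall>i. \<exists>U V. qopen X \<rho> U \<and> qopen X \<rho> V \<and> A i \<subseteq> U \<and> X - A i \<subseteq> V
        \<and> measure N (U \<inter> V) < e / 4 * (1 / 2) ^ i"
      by (intro allI, rule Union.IH) (use Union.prems in simp)
    then obtain U V where UV: "\<And>i. qopen X \<rho> (U i)" "\<And>i. qopen X \<rho> (V i)" "\<And>i. A i \<subseteq> U i"
      "\<And>i. X - A i \<subseteq> V i" "\<And>i. measure N (U i \<inter> V i) < e / 4 * (1 / 2) ^ i" by metis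
    note [measurable] = opn[OF UV(1)] opn[OF UV(2)]
    have "(\<lambda>n. measure N (\<Union>i\<le>n. U i)) \<longlonglongrightarrow> measure N (\<Union>n. \<Union>i\<le>n. U i)"
      by (intro finite_Lim_measure_incseq) (auto simp: incseq_def intro: order_trans)
    also have "(\<Union>n. \<Union>i\<le>n. U i) = (\<Union>i. U i)" by auto
    finally have "eventually (\<lambda>n. measure N (\<Union>i. U i) - e / 2 < measure N (\<Union>i\<le>n. U i)) sequentially"
      using Union.prems by (intro order_tendstoD) auto
    then obtain n where n: "measure N (\<Union>i. U i) - e / 2 < measure N (\<Union>i\<le>n. U i)"
      by (auto simp: eventually_sequentially)
    have "measure N ((\<Union>i. U i) \<inter> (\<Inter>i\<le>n. V i))
        \<le> measure N (((\<Union>i. U i) - (\<Union>i\<le>n. U i)) \<union> (\<Union>i\<le>n. U i \<inter> V i))"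
      by (intro finite_measure_mono) auto
    also have "\<dots> \<le> measure N ((\<Union>i. U i) - (\<Union>i\<le>n. U i)) + measure N (\<Union>i\<le>n. U i \<inter> V i)"
      by (intro measure_Un_le) auto
    also have "measure N ((\<Union>i. U i) - (\<Union>i\<le>n. U i)) < e / 2"
      using n by (subst finite_measure_Diff) auto
    also have "measure N (\<Union>i\<le>n. U i \<inter> V i) \<le> (\<Sum>i\<le>n. measure N (U i \<inter> V i))"
      by (intro finite_measure_subadditive_finite) auto
    also have "\<dots> \<le> (\<Sum>i\<le>n. e / 4 * (1 / 2) ^ i)"
      using UV(5) by (intro sum_mono less_imp_le)
    also have "\<dots> = e / 4 * (\<Sum>i\<le>n. (1 / 2) ^ i)" by (simp add: sum_distrib_left)
    also have "(\<Sum>i\<le>n. (1 / 2) ^ i) \<le> (2::real)" using sum_gp0[of "1 / 2 :: real" n] by simp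
    finally have "measure N ((\<Union>i. U i) \<inter> (\<Inter>i\<le>n. V i)) < e" using Union.prems by simp
    moreover have "qopen X \<rho> (\<Union>i. U i)" "qopen X \<rho> (\<Inter>i\<le>n. V i)"
      using UV by (auto intro!: qopen_UN qopen_finite_INT)
    moreover have "(\<Union>i. A i) \<subseteq> (\<Union>i. U i)" using UV(3) by blast
    moreover have "X - (\<Union>i. A i) \<subseteq> (\<Inter>i\<le>n. V i)" using UV(4) by blast
    ultimately show ?case by (intro exI[of _ "\<Union>i. U i"] exI[of _ "\<Inter>i\<le>n. V i"]) simp
  qed
qed

end

section \<open>Doubling measures and points of low density\<close>

lemma iterated_doubling:
  fixes m :: "'a \<Rightarrow> real \<Rightarrow> real"
  assumes nonneg: "\<And>x r. x \<in> S \<Longrightarrow> 0 < r \<Longrightarrow> 0 \<le> m x r"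
    and mono: "\<And>x r s. x \<in> S \<Longrightarrow> 0 < r \<Longrightarrow> r \<le> s \<Longrightarrow> m x r \<le> m x s"
    and dbl: "\<And>x r. x \<in> S \<Longrightarrow> 0 < r \<Longrightarrow> m x (2 * r) \<le> c * m x r"
    and H: "0 < H"
  obtains D where "1 \<le> D" "\<And>x r. x \<in> S \<Longrightarrow> 0 < r \<Longrightarrow> m x (H * r) \<le> D * m x r"
proof -
  obtain n where n: "H < 2 ^ n" using real_arch_pow[of 2 H] by auto
  define d where "d = max c 1"
  have iter: "m x (2 ^ k * r) \<le> d ^ k * m x r" if x: "x \<in> S" "0 < r" for x r k
  proof (induction k)
    case (Suc k)
    have "m x (2 ^ Suc k * r) \<le> c * m x (2 ^ k * r)"
      using dbl[of x "2 ^ k * r"] x by (simp add: mult.assoc)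
    also have "\<dots> \<le> d * m x (2 ^ k * r)"
      using nonneg x by (intro mult_right_mono) (auto simp: d_def)
    also have "\<dots> \<le> d * (d ^ k * m x r)"
      using Suc by (intro mult_left_mono) (auto simp: d_def)
    finally show ?case by (simp add: mult.assoc)
  qed simp
  have "m x (H * r) \<le> d ^ n * m x r" if x: "x \<in> S" "0 < r" for x r
  proof -
    have "m x (H * r) \<le> m x (2 ^ n * r)" using n x H by (intro mono) auto
    then show ?thesis using iter[OF x, of n] by simp
  qed
  moreover have "1 \<le> d ^ n" by (simp add: d_def one_le_power)
  ultimately show ?thesis using that by blast
qed

lemma small_covers_imp_null:
  assumes "\<And>e. 0 < e \<Longrightarrow> \<exists>T\<in>sets M. Z \<subseteq> T \<and> emeasure M T \<le> ennreal e"
  shows "\<exists>N\<in>null_sets M. Z \<subseteq> N"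
proof -
  have "\<forall>n. \<exists>T\<in>sets M. Z \<subseteq> T \<and> emeasure M T \<le> ennreal (inverse (real (Suc n)))"
    using assms by simp
  then obtain T where T: "\<And>n. T n \<in> sets M" "\<And>n. Z \<subseteq> T n"
    "\<And>n. emeasure M (T n) \<le> ennreal (inverse (real (Suc n)))" by metis
  have le: "emeasure M (\<Inter>n. T n) \<le> ennreal (inverse (real (Suc n)))" for n
    using T by (intro order_trans[OF emeasure_mono T(3)]) auto
  have "emeasure M (\<Inter>n. T n) \<le> ennreal 0"
  proof (rule LIMSEQ_le_const)
    show "(\<lambda>n. ennreal (inverse (real (Suc n)))) \<longlonglongrightarrow> ennreal 0"
      by (intro tendsto_ennrealI LIMSEQ_inverse_real_of_nat)
  qed (use le in blast)
  then have "(\<Inter>n. T n) \<in> null_sets M" using T(1) by (intro null_setsI) auto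
  then show ?thesis using T(2) by blast
qed

lemma emeasure_UN_le_count_space:
  assumes "countable I" "\<And>i. i \<in> I \<Longrightarrow> A i \<in> sets M"
  shows "emeasure M (\<Union>i\<in>I. A i) \<le> (\<integral>\<^sup>+i. emeasure M (A i) \<partial>count_space I)"
proof -
  have "emeasure M (\<Union>i\<in>I. A i) = (\<integral>\<^sup>+x. indicator (\<Union>i\<in>I. A i) x \<partial>M)"
    using assms by (intro nn_integral_indicator[symmetric] sets.countable_UN') auto
  also have "\<dots> \<le> (\<integral>\<^sup>+x. \<integral>\<^sup>+i. indicator (A i) x \<partial>count_space I \<partial>M)"
  proof (rule nn_integral_mono)
    fix x
    show "indicator (\<Union>i\<in>I. A i) x \<le> (\<integral>\<^sup>+i. indicator (A i) x \<partial>count_space I :: ennreal)"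
    proof (cases "x \<in> (\<Union>i\<in>I. A i)")
      case True
      then obtain i where "i \<in> I" "x \<in> A i" by blast
      then show ?thesis using True nn_integral_ge_point[of i I "\<lambda>i. indicator (A i) x"] by simp
    qed simp
  qed
  also have "\<dots> = (\<integral>\<^sup>+i. \<integral>\<^sup>+x. indicator (A i) x \<partial>M \<partial>count_space I)"
    using assms by (intro nn_integral_count_space_nn_integral) auto
  also have "\<dots> = (\<integral>\<^sup>+i. emeasure M (A i) \<partial>count_space I)"
    using assms by (intro nn_integral_cong) simp
  finally show ?thesis .
qed

locale homogeneous_constant_space = homogeneous_type_space M \<rho> + quasi_metric_constant "space M" \<rho> \<kappa>
  for M :: "'a measure" and \<rho> \<kappa>
begin

abbreviation B :: "'a \<Rightarrow> real \<Rightarrow> 'a set" where "B \<equiv> qball (space M) \<rho>"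

lemma emeasure_qball: "x \<in> space M \<Longrightarrow> 0 < r \<Longrightarrow> emeasure M (B x r) = ennreal (measure M (B x r))"
  using qball_finite by (intro emeasure_eq_ennreal_measure) (auto simp: less_top)

lemma measure_qball_pos: "x \<in> space M \<Longrightarrow> 0 < r \<Longrightarrow> 0 < measure M (B x r)"
  using qball_pos[of x r] emeasure_qball[of x r] by (simp add: ennreal_less_zero_iff)

lemma measure_qball_mono:
  assumes "x \<in> space M" "y \<in> space M" "0 < r" "0 < s" "B x r \<subseteq> B y s"
  shows "measure M (B x r) \<le> measure M (B y s)"
  using assms qball_measurable qball_finite by (intro measure_mono_fmeasurable) (auto simp: fmeasurable_def)

lemma dilated_qball_measure:
  assumes "0 < H"
  obtains D where "1 \<le> D" "\<And>x r. x \<in> space M \<Longrightarrow> 0 < r \<Longrightarrow> measure M (B x (H * r)) \<le> D * measure M (B x r)"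
proof -
  obtain c where c: "\<forall>x\<in>space M. \<forall>r>0. measure M (B x (2 * r)) \<le> c * measure M (B x r)"
    using doubling by blast
  show ?thesis
  proof (rule iterated_doubling[where S = "space M" and m = "\<lambda>x r. measure M (B x r)" and c = c and H = H])
    show "measure M (B x r) \<le> measure M (B x s)" if "x \<in> space M" "0 < r" "r \<le> s" for x r s
      using that by (intro measure_qball_mono qball_mono) auto
  qed (use c assms that in auto)
qed

lemma countable_disjoint_qballs:
  assumes I: "I \<subseteq> space M" "\<And>i. i \<in> I \<Longrightarrow> 0 < t i"
    and disj: "disjoint_family_on (\<lambda>i. B i (t i)) I"
    and S: "S \<in> sets M" "emeasure M S < \<infinity>" "\<And>i. i \<in> I \<Longrightarrow> B i (t i) \<subseteq> S"
  shows "countable I"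
proof -
  have fm: "B i (t i) \<in> sets M" "emeasure M (B i (t i)) \<noteq> \<infinity>" if "i \<in> I" for i
    using I(2)[OF that] I(1) that qball_measurable[of i "t i"] qball_finite[of i "t i"] by auto
  have "(\<lambda>i. measure M (B i (t i))) summable_on I"
  proof (rule nonneg_bdd_above_summable_on)
    show "bdd_above (sum (\<lambda>i. measure M (B i (t i))) ` {F. F \<subseteq> I \<and> finite F})"
    proof (rule bdd_aboveI2)
      fix F assume "F \<in> {F. F \<subseteq> I \<and> finite F}"
      then have F: "F \<subseteq> I" "finite F" by auto
      have "(\<Sum>i\<in>F. measure M (B i (t i))) = measure M (\<Union>i\<in>F. B i (t i))"
        using F fm disjoint_family_on_mono[OF F(1) disj]
        by (intro measure_finite_Union[symmetric]) auto
      also have "\<dots> \<le> measure M S"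
      proof (rule measure_mono_fmeasurable)
        show "(\<Union>i\<in>F. B i (t i)) \<subseteq> S" using F S(3) by blast
        show "(\<Union>i\<in>F. B i (t i)) \<in> sets M" using F fm by (intro sets.finite_UN) auto
        show "S \<in> fmeasurable M" using S by (auto simp: fmeasurable_def)
      qed
      finally show "(\<Sum>i\<in>F. measure M (B i (t i))) \<le> measure M S" .
    qed
  qed simp
  then have "countable {i\<in>I. measure M (B i (t i)) \<noteq> 0}" by (rule summable_countable_real)
  also have "{i\<in>I. measure M (B i (t i)) \<noteq> 0} = I"
    using I measure_qball_pos by (force simp: less_le)
  finally show ?thesis .
qed

text \<open>Replace \<open>A\<close> by a Borel set \<open>E\<close> up to a null set and choose an open \<open>U \<supseteq> E\<close> with
  \<open>U - E\<close> of small measure inside a large ball. Small balls around the exceptional points lie in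
  \<open>U\<close>, and a fixed proportion of each lies outside \<open>A\<close>, hence in \<open>U - E\<close> up to a null set. So
  disjoint ones have small total measure, and by Vitali's lemma and doubling their dilates still
  do while covering the exceptional set.\<close>
lemma low_density_points_null:
  assumes semi: "borel_semiregular M \<rho>"
    and x: "x \<in> space M" "0 < R" and A: "A \<in> sets M" "A \<subseteq> B x R"
    and c: "0 \<le> c" "c < 1" and r0: "0 < r0"
  shows "\<exists>N\<in>null_sets M. {y\<in>A. \<forall>s. 0 < s \<and> s < r0 \<longrightarrow>
    measure M (B y s \<inter> A) \<le> c * measure M (B y s)} \<subseteq> N"
proof -
  have k: "1 \<le> \<kappa>" by (rule one_le_constant)
  obtain D where D: "1 \<le> D"
    "\<And>x r. x \<in> space M \<Longrightarrow> 0 < r \<Longrightarrow> measure M (B x (3 * \<kappa> * r)) \<le> D * measure M (B x r)"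
    using dilated_qball_measure[of "3 * \<kappa>"] k by auto
  define S where "S = B x (\<kappa> * (R + r0))"
  have S: "S \<in> sets M" "emeasure M S < \<infinity>"
    using x r0 k qball_measurable qball_finite by (auto simp: S_def)
  have "emeasure M A < \<infinity>"
    using le_less_trans[OF emeasure_mono[OF A(2)]] qball_measurable qball_finite x by blast
  then obtain E where E: "E \<in> qborel_sets (space M) \<rho>" "emeasure M ((A - E) \<union> (E - A)) = 0"
    using semi A(1) unfolding borel_semiregular_def by blast
  then have EM: "E \<in> sets M" using borel_measurable_sets by blast
  define O' where "O' = (A - E) \<union> (E - A)"
  have O': "O' \<in> null_sets M" using E(2) A(1) EM by (auto simp: O'_def intro: null_setsI)
  define N where "N = density M (indicator S)"
  have N: "emeasure N T = emeasure M (S \<inter> T)" if "T \<in> sets M" for T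
    using that S by (simp add: N_def emeasure_density indicator_inter_arith[symmetric])
  have fin: "finite_measure N"
  proof
    show "emeasure N (space N) \<noteq> \<infinity>" using N[of "space M"] S sets.sets_into_space[OF S(1)]
      by (simp add: N_def Int_absorb2)
  qed
  define Z where "Z = {y\<in>A. \<forall>s. 0 < s \<and> s < r0 \<longrightarrow> measure M (B y s \<inter> A) \<le> c * measure M (B y s)}"
  have "\<exists>T\<in>sets M. Z \<inter> E \<subseteq> T \<and> emeasure M T \<le> ennreal e" if e: "0 < e" for e
  proof -
    define e' where "e' = e * (1 - c) / D"
    have e': "0 < e'" "D / (1 - c) * e' = e" using e c D by (auto simp: e'_def)
    obtain U V where UV: "qopen (space M) \<rho> U" "qopen (space M) \<rho> V" "E \<subseteq> U" "space M - E \<subseteq> V"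
      "measure N (U \<inter> V) < e'"
      using borel_regularity[OF fin _ _ E(1) e'(1)] borel_measurable_sets by (auto simp: N_def)
    have UVM: "U \<in> sets M" "V \<in> sets M"
      using UV(1,2) borel_measurable_sets by (auto simp: qborel_sets_def)
    have ZA: "Z \<subseteq> A" and ZM: "Z \<subseteq> space M" using sets.sets_into_space[OF A(1)] by (auto simp: Z_def)
    have "\<exists>s. 0 < s \<and> s < r0 \<and> B y s \<subseteq> U" if "y \<in> Z \<inter> E" for y
    proof -
      have "\<forall>y\<in>U. \<exists>s>0. B y s \<subseteq> U" using UV(1) by (simp add: qopen_def)
      moreover have "y \<in> U" using that UV(3) by auto
      ultimately obtain s where "s > 0" "B y s \<subseteq> U" by auto
      moreover have "B y (min s (r0 / 2)) \<subseteq> B y s" by (intro qball_mono) simp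
      ultimately show ?thesis using r0 by (intro exI[of _ "min s (r0 / 2)"]) auto
    qed
    then obtain t where t: "\<And>y. y \<in> Z \<inter> E \<Longrightarrow> 0 < t y \<and> t y < r0 \<and> B y (t y) \<subseteq> U" by metis
    have ZE: "Z \<inter> E \<subseteq> space M" using ZM by blast
    have tr: "0 < t y \<and> t y \<le> r0" if "y \<in> Z \<inter> E" for y using t[OF that] by simp
    obtain I where I: "I \<subseteq> Z \<inter> E" "disjoint_family_on (\<lambda>i. B i (t i)) I"
      "Z \<inter> E \<subseteq> (\<Union>i\<in>I. B i (3 * \<kappa> * t i))"
      by (rule vitali_covering[OF ZE tr])
    have i: "i \<in> space M" "0 < t i" "t i < r0" "B i (t i) \<subseteq> U" "i \<in> Z" if "i \<in> I" for i
      using that I(1) t ZM by auto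
    have BS: "B i (t i) \<subseteq> S" if "i \<in> I" for i
    proof -
      have "B i (t i) \<subseteq> B x (\<kappa> * (R + t i))"
        using i(5)[OF that] ZA A(2) x(1) by (intro qball_subset_qball) auto
      also have "\<dots> \<subseteq> S" unfolding S_def using i(3)[OF that] k by (intro qball_mono) auto
      finally show ?thesis .
    qed
    have cI: "countable I" by (rule countable_disjoint_qballs[OF _ _ I(2) S BS]) (use i in auto)
    have [measurable]: "B i (t i) \<in> sets M" "B i (3 * \<kappa> * t i) \<in> sets M" if "i \<in> I" for i
      using i[OF that] k by (auto intro!: qball_measurable)
    have one: "emeasure M (B i (3 * \<kappa> * t i)) \<le> ennreal (D / (1 - c)) * emeasure M (B i (t i) - A)"
      if "i \<in> I" for i
    proof -
      have f: "B i (t i) \<in> fmeasurable M"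
        using i[OF that] qball_measurable qball_finite by (auto simp: fmeasurable_def)
      have "measure M (B i (t i)) = measure M (B i (t i) \<inter> A) + measure M (B i (t i) - A)"
        using f A(1) measure_Un_AE[of "B i (t i) \<inter> A" "B i (t i) - A" M]
          fmeasurable_Int_fmeasurable[OF f A(1)] fmeasurable_Diff[OF f A(1)]
        by (simp add: Int_Diff_Un)
      also have "measure M (B i (t i) \<inter> A) \<le> c * measure M (B i (t i))"
        using i[OF that] by (auto simp: Z_def)
      finally have "measure M (B i (t i)) \<le> measure M (B i (t i) - A) / (1 - c)"
        using c by (simp add: field_simps)
      then have "D * measure M (B i (t i)) \<le> D * (measure M (B i (t i) - A) / (1 - c))"
        using D by (intro mult_left_mono) auto
      then have "measure M (B i (3 * \<kappa> * t i)) \<le> D / (1 - c) * measure M (B i (t i) - A)"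
        using D(2)[of i "t i"] i[OF that] by simp
      then show ?thesis
        using emeasure_qball[of i "3 * \<kappa> * t i"] i[OF that] k c D f A(1)
        by (simp add: emeasure_eq_measure2 fmeasurable_Diff ennreal_mult'[symmetric] ennreal_leI)
    qed
    have "emeasure M (\<Union>i\<in>I. B i (3 * \<kappa> * t i)) \<le> (\<integral>\<^sup>+i. emeasure M (B i (3 * \<kappa> * t i)) \<partial>count_space I)"
      using cI by (intro emeasure_UN_le_count_space) auto
    also have "\<dots> \<le> (\<integral>\<^sup>+i. ennreal (D / (1 - c)) * emeasure M (B i (t i) - A) \<partial>count_space I)"
      using one by (intro nn_integral_mono) auto
    also have "\<dots> = ennreal (D / (1 - c)) * (\<integral>\<^sup>+i. emeasure M (B i (t i) - A) \<partial>count_space I)"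
      by (intro nn_integral_cmult) auto
    also have "(\<integral>\<^sup>+i. emeasure M (B i (t i) - A) \<partial>count_space I) = emeasure M (\<Union>i\<in>I. B i (t i) - A)"
      using cI I(2) A(1) by (intro emeasure_UN_countable[symmetric]) (auto simp: disjoint_family_on_def)
    also have "\<dots> \<le> emeasure M (S \<inter> (U \<inter> V) \<union> O')"
    proof (rule emeasure_mono)
      show "(\<Union>i\<in>I. B i (t i) - A) \<subseteq> S \<inter> (U \<inter> V) \<union> O'"
      proof
        fix z assume "z \<in> (\<Union>i\<in>I. B i (t i) - A)"
        then have z: "z \<in> U" "z \<in> S" "z \<notin> A" using i(4) BS by auto
        then have "z \<in> E \<or> z \<in> V" using UV(4) sets.sets_into_space[OF S(1)] by auto
        then show "z \<in> S \<inter> (U \<inter> V) \<union> O'" using z by (auto simp: O'_def)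
      qed
    qed (use UVM S O' in auto)
    also have "\<dots> = emeasure M (S \<inter> (U \<inter> V))"
      using UVM S O' by (intro emeasure_Un_null_set) auto
    also have "\<dots> = emeasure N (U \<inter> V)" using N UVM by auto
    also have "\<dots> = ennreal (measure N (U \<inter> V))" using fin by (rule finite_measure.emeasure_eq_measure)
    also have "\<dots> \<le> ennreal e'" using UV(5) by (intro ennreal_leI) simp
    also have "ennreal (D / (1 - c)) * ennreal e' = ennreal e"
      using e' D c by (simp add: ennreal_mult'[symmetric])
    finally have "emeasure M (\<Union>i\<in>I. B i (3 * \<kappa> * t i)) \<le> ennreal e"
      by (auto simp: mult_left_mono)
    then show ?thesis using I(3) cI by (intro bexI[of _ "\<Union>i\<in>I. B i (3 * \<kappa> * t i)"]) auto
  qed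
  then obtain N' where N': "N' \<in> null_sets M" "Z \<inter> E \<subseteq> N'"
    using small_covers_imp_null[of M "Z \<inter> E"] by blast
  have "Z \<subseteq> N' \<union> O'" using N'(2) by (auto simp: Z_def O'_def)
  moreover have "N' \<union> O' \<in> null_sets M" using N'(1) O' by auto
  ultimately show ?thesis unfolding Z_def by blast
qed

text \<open>If the mean of \<open>w\<close> over a ball is at most \<open>l\<close>, then by Markov's inequality \<open>{w > l'}\<close>
  occupies at most the proportion \<open>l / l' < 1\<close> of the ball; so the points in question have low
  density in \<open>{w > l'}\<close>. The exceptional set is only claimed to lie in a null set, since the
  condition quantifies over uncountably many radii.\<close>
lemma exceeding_small_averages_null:
  assumes semi: "borel_semiregular M \<rho>" and x: "x \<in> space M" "0 < R"
    and w[measurable]: "w \<in> borel_measurable M" and l: "0 \<le> l" "l < l'" and r0: "0 < r0"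
  shows "\<exists>N\<in>null_sets M. {y\<in>B x R. l' < w y \<and> (\<forall>s. 0 < s \<and> s < r0 \<longrightarrow>
    emeasure (density M (\<lambda>z. ennreal (w z))) (B y s) \<le> ennreal (l * measure M (B y s)))} \<subseteq> N"
proof -
  define A where "A = {y\<in>B x R. l' < w y}"
  have [measurable]: "B x R \<in> sets M" using x by (rule qball_measurable)
  have "A = B x R \<inter> {y\<in>space M. l' < w y}" using qball_subset_space by (auto simp: A_def)
  then have A[measurable]: "A \<in> sets M" by simp
  have "measure M (B y s \<inter> A) \<le> l / l' * measure M (B y s)"
    if y: "y \<in> space M" and s: "0 < s"
      and le: "emeasure (density M (\<lambda>z. ennreal (w z))) (B y s) \<le> ennreal (l * measure M (B y s))" for y s
  proof -
    have [measurable]: "B y s \<in> sets M" using y s by (rule qball_measurable)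
    then have f: "B y s \<inter> A \<in> fmeasurable M"
      using qball_finite[OF y s] by (intro fmeasurable_Int_fmeasurable) (auto simp: fmeasurable_def)
    have "ennreal (l' * measure M (B y s \<inter> A)) = (\<integral>\<^sup>+z. ennreal l' * indicator (B y s \<inter> A) z \<partial>M)"
      using f l by (simp add: nn_integral_cmult_indicator emeasure_eq_measure2 ennreal_mult')
    also have "\<dots> \<le> (\<integral>\<^sup>+z. ennreal (w z) * indicator (B y s) z \<partial>M)"
      by (intro nn_integral_mono) (auto simp: A_def split: split_indicator intro!: ennreal_leI)
    also have "\<dots> = emeasure (density M (\<lambda>z. ennreal (w z))) (B y s)"
      by (simp add: emeasure_density)
    also note le
    finally have "l' * measure M (B y s \<inter> A) \<le> l * measure M (B y s)"
      using l by (simp add: ennreal_le_iff)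
    then show ?thesis using l by (simp add: field_simps)
  qed
  then have sub: "{y\<in>B x R. l' < w y \<and> (\<forall>s. 0 < s \<and> s < r0 \<longrightarrow>
    emeasure (density M (\<lambda>z. ennreal (w z))) (B y s) \<le> ennreal (l * measure M (B y s)))}
    \<subseteq> {y\<in>A. \<forall>s. 0 < s \<and> s < r0 \<longrightarrow> measure M (B y s \<inter> A) \<le> l / l' * measure M (B y s)}"
    using qball_subset_space[of x R] by (auto simp: A_def)
  obtain N where N: "N \<in> null_sets M"
    "{y\<in>A. \<forall>s. 0 < s \<and> s < r0 \<longrightarrow> measure M (B y s \<inter> A) \<le> l / l' * measure M (B y s)} \<subseteq> N"
    using low_density_points_null[OF semi x A _ _ _ r0, of "l / l'"] l A_def by force
  show ?thesis using N(1) subset_trans[OF sub N(2)] by (intro bexI[of _ N])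
qed

end

section \<open>Stopping balls of a reverse Hoelder weight\<close>

text \<open>The dilation factor \<open>\<kappa> (1 + 3\<kappa>)\<close> comes from the fact that a ball of radius at most \<open>3\<kappa>r\<close>
  centred in \<open>B x r\<close> is contained in \<open>B x (\<kappa> (1 + 3\<kappa>) r)\<close>; it also exceeds the factor \<open>3\<kappa>\<close> of
  Vitali's lemma and the factor \<open>2\<kappa>\<close> by which the stopping balls may enlarge a ball. The
  reverse Hoelder inequality is raised to the power \<open>p\<close>, so that it bounds the measure \<open>\<sigma>\<close>.\<close>
locale reverse_hoelder_space = homogeneous_constant_space M \<rho> \<kappa>
  for M :: "'a measure" and \<rho> \<kappa> +
  fixes w :: "'a \<Rightarrow> real" and p C D :: real and \<nu> \<sigma> :: "'a measure" and avg :: "'a \<Rightarrow> real \<Rightarrow> real"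
  defines "\<nu> \<equiv> density M (\<lambda>x. ennreal (w x))"
    and "\<sigma> \<equiv> density M (\<lambda>x. ennreal (w x powr p))"
    and "avg \<equiv> \<lambda>x r. measure \<nu> (B x r) / measure M (B x r)"
  assumes semiregular: "borel_semiregular M \<rho>"
    and p: "1 < p"
    and w_measurable[measurable]: "w \<in> borel_measurable M"
    and w_nonneg: "\<And>x. x \<in> space M \<Longrightarrow> 0 \<le> w x"
    and nu_finite: "\<And>x r. x \<in> space M \<Longrightarrow> 0 < r \<Longrightarrow> emeasure \<nu> (B x r) < \<infinity>"
    and D: "1 \<le> D"
    and measure_dilate: "\<And>x r. x \<in> space M \<Longrightarrow> 0 < r \<Longrightarrow>
      measure M (B x (\<kappa> * (1 + 3 * \<kappa>) * r)) \<le> D * measure M (B x r)"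
    and nu_dilate: "\<And>x r. x \<in> space M \<Longrightarrow> 0 < r \<Longrightarrow>
      measure \<nu> (B x (\<kappa> * (1 + 3 * \<kappa>) * r)) \<le> D * measure \<nu> (B x r)"
    and C: "0 \<le> C"
    and reverse_hoelder: "\<And>x r. x \<in> space M \<Longrightarrow> 0 < r \<Longrightarrow>
      emeasure \<sigma> (B x r) \<le> ennreal (C * measure M (B x r) * avg x r powr p)"
begin

definition superlevel :: "real \<Rightarrow> 'a set" where "superlevel l = {y \<in> space M. l < w y}"

lemma sets_nu[measurable_cong, simp]: "sets \<nu> = sets M" by (simp add: \<nu>_def)
lemma sets_sigma[measurable_cong, simp]: "sets \<sigma> = sets M" by (simp add: \<sigma>_def)

lemma superlevel_measurable[measurable]: "superlevel l \<in> sets M"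
  unfolding superlevel_def by measurable

lemma emeasure_nu: "A \<in> sets M \<Longrightarrow> emeasure \<nu> A = (\<integral>\<^sup>+x. ennreal (w x) * indicator A x \<partial>M)"
  by (simp add: \<nu>_def emeasure_density)

lemma emeasure_sigma: "A \<in> sets M \<Longrightarrow> emeasure \<sigma> A = (\<integral>\<^sup>+x. ennreal (w x powr p) * indicator A x \<partial>M)"
  by (simp add: \<sigma>_def emeasure_density)

lemma nu_fmeasurable: "x \<in> space M \<Longrightarrow> 0 < r \<Longrightarrow> B x r \<in> fmeasurable \<nu>"
  using nu_finite qball_measurable by (auto simp: fmeasurable_def)

lemma sigma_finite: "x \<in> space M \<Longrightarrow> 0 < r \<Longrightarrow> emeasure \<sigma> (B x r) < \<infinity>"
  using reverse_hoelder[of x r] by (simp add: le_less_trans[OF _ ennreal_less_top])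

lemma sigma_fmeasurable: "x \<in> space M \<Longrightarrow> 0 < r \<Longrightarrow> B x r \<in> fmeasurable \<sigma>"
  using sigma_finite qball_measurable by (auto simp: fmeasurable_def)

lemma avg_nonneg: "0 \<le> avg x r"
  by (simp add: avg_def)

lemma measure_nu_eq: "x \<in> space M \<Longrightarrow> 0 < r \<Longrightarrow> measure \<nu> (B x r) = avg x r * measure M (B x r)"
  using measure_qball_pos[of x r] by (simp add: avg_def)

lemma measure_nu_mono:
  assumes "x \<in> space M" "y \<in> space M" "0 < r" "0 < s" "B x r \<subseteq> B y s"
  shows "measure \<nu> (B x r) \<le> measure \<nu> (B y s)"
  using assms nu_fmeasurable qball_measurable by (intro measure_mono_fmeasurable) auto

lemma measure_dilate_le:
  assumes "x \<in> space M" "0 < r" "0 < s" "s \<le> \<kappa> * (1 + 3 * \<kappa>) * r"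
  shows "measure M (B x s) \<le> D * measure M (B x r)"
  using assms measure_dilate[OF assms(1,2)]
  by (intro order_trans[OF measure_qball_mono[of x x s "\<kappa> * (1 + 3 * \<kappa>) * r"]])
    (auto intro!: qball_mono)

lemma nu_dilate_le:
  assumes "x \<in> space M" "0 < r" "0 < s" "s \<le> \<kappa> * (1 + 3 * \<kappa>) * r"
  shows "measure \<nu> (B x s) \<le> D * measure \<nu> (B x r)"
  using assms nu_dilate[OF assms(1,2)]
  by (intro order_trans[OF measure_nu_mono[of x x s "\<kappa> * (1 + 3 * \<kappa>) * r"]])
    (auto intro!: qball_mono)

text \<open>The part of the ball where \<open>w \<le> l/2\<close> contributes at most half of \<open>l \<mu>(B)\<close> to the integral
  of \<open>w\<close>.\<close>
lemma avg_le_imp_superlevel_mass: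
  assumes x: "x \<in> space M" "0 < r" and l: "0 < l" "l \<le> avg x r"
  shows "l * measure M (B x r) \<le> 2 * measure \<nu> (B x r \<inter> superlevel (l / 2))"
proof -
  let ?U = "superlevel (l / 2)"
  note f = nu_fmeasurable[OF x]
  have [measurable]: "B x r \<in> sets M" using x by (rule qball_measurable)
  have fi: "B x r \<inter> ?U \<in> fmeasurable \<nu>" "B x r - ?U \<in> fmeasurable \<nu>"
    using f by (auto intro: fmeasurable_Int_fmeasurable fmeasurable_Diff)
  have "emeasure \<nu> (B x r - ?U) = (\<integral>\<^sup>+y. ennreal (w y) * indicator (B x r - ?U) y \<partial>M)"
    by (simp add: emeasure_nu)
  also have "\<dots> \<le> (\<integral>\<^sup>+y. ennreal (l / 2) * indicator (B x r) y \<partial>M)"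
    by (intro nn_integral_mono) (auto simp: superlevel_def split: split_indicator intro!: ennreal_leI)
  also have "\<dots> = ennreal (l / 2 * measure M (B x r))"
    using l emeasure_qball[OF x] by (simp add: nn_integral_cmult_indicator ennreal_mult'[symmetric])
  finally have "measure \<nu> (B x r - ?U) \<le> l / 2 * measure M (B x r)"
    using fi(2) l by (simp add: emeasure_eq_measure2 ennreal_le_iff)
  moreover have "measure \<nu> (B x r) = measure \<nu> (B x r \<inter> ?U) + measure \<nu> (B x r - ?U)"
    using fi measure_Un_AE[of "B x r \<inter> ?U" "B x r - ?U" \<nu>] by (simp add: Int_Diff_Un)
  moreover have "l * measure M (B x r) \<le> measure \<nu> (B x r)"
    using l by (auto simp: measure_nu_eq[OF x] intro: mult_right_mono)
  ultimately show ?thesis by simp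
qed

text \<open>Jensen's inequality up to the factor \<open>2\<^sup>p\<close>: at least half of the integral of \<open>w\<close> comes
  from where \<open>w > a/2\<close>, and there \<open>w\<^sup>p \<ge> (a/2)\<^sup>p\<^sup>-\<^sup>1 w\<close>.\<close>
lemma avg_powr_le_sigma:
  assumes x: "x \<in> space M" "0 < r"
  shows "avg x r powr p * measure M (B x r) \<le> 2 powr p * measure \<sigma> (B x r)"
proof (cases "avg x r = 0")
  case False
  define a where "a = avg x r"
  have a: "0 < a" using False avg_nonneg[of x r] by (simp add: a_def)
  let ?U = "superlevel (a / 2)"
  have [measurable]: "B x r \<in> sets M" using x by (rule qball_measurable)
  have fi: "B x r \<inter> ?U \<in> fmeasurable \<nu>"
    using nu_fmeasurable[OF x] by (auto intro: fmeasurable_Int_fmeasurable)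
  have "ennreal ((a / 2) powr (p - 1) * measure \<nu> (B x r \<inter> ?U))
      = ennreal ((a / 2) powr (p - 1)) * emeasure \<nu> (B x r \<inter> ?U)"
    using fi by (simp add: emeasure_eq_measure2 ennreal_mult')
  also have "\<dots> = (\<integral>\<^sup>+y. ennreal ((a / 2) powr (p - 1)) * (ennreal (w y) * indicator (B x r \<inter> ?U) y) \<partial>M)"
    by (simp add: emeasure_nu nn_integral_cmult)
  also have "\<dots> \<le> (\<integral>\<^sup>+y. ennreal (w y powr p) * indicator (B x r) y \<partial>M)"
  proof (rule nn_integral_mono)
    fix y assume y: "y \<in> space M"
    have "(a / 2) powr (p - 1) * w y \<le> w y powr p" if "a / 2 < w y"
    proof -
      have "(a / 2) powr (p - 1) * w y \<le> w y powr (p - 1) * w y"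
        using that a p by (intro mult_right_mono powr_mono2) auto
      also have "\<dots> = w y powr p" using that a by (simp add: powr_diff)
      finally show ?thesis .
    qed
    then show "ennreal ((a / 2) powr (p - 1)) * (ennreal (w y) * indicator (B x r \<inter> ?U) y)
        \<le> ennreal (w y powr p) * indicator (B x r) y"
      by (auto simp: superlevel_def ennreal_mult'[symmetric] split: split_indicator intro!: ennreal_leI)
  qed
  also have "\<dots> = ennreal (measure \<sigma> (B x r))"
    using sigma_fmeasurable[OF x] by (simp add: emeasure_sigma[symmetric] emeasure_eq_measure2)
  finally have "(a / 2) powr (p - 1) * measure \<nu> (B x r \<inter> ?U) \<le> measure \<sigma> (B x r)"
    by (simp add: ennreal_le_iff)
  moreover have "a * measure M (B x r) \<le> 2 * measure \<nu> (B x r \<inter> ?U)"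
    using avg_le_imp_superlevel_mass[OF x a] by (simp add: a_def)
  then have "(a / 2) powr (p - 1) * (a / 2 * measure M (B x r)) \<le> (a / 2) powr (p - 1) * measure \<nu> (B x r \<inter> ?U)"
    by (intro mult_left_mono) auto
  moreover have "(a / 2) powr (p - 1) * (a / 2) = a powr p / 2 powr p"
    using a by (simp add: powr_diff powr_divide)
  then have "a powr p / 2 powr p * measure M (B x r) = (a / 2) powr (p - 1) * (a / 2 * measure M (B x r))"
    by (simp only: mult.assoc[symmetric])
  ultimately have "a powr p / 2 powr p * measure M (B x r) \<le> measure \<sigma> (B x r)"
    by linarith
  then show ?thesis by (simp add: a_def field_simps)
qed (use p in simp)

text \<open>\<open>B y s\<close> lies in a fixed dilate of \<open>B x r\<close>, and \<open>B x r\<close> in one of \<open>B y r\<close>; doubling of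
  \<open>\<nu>\<close> and of \<open>\<mu>\<close> contributes one factor \<open>D\<close> each.\<close>
lemma avg_comparison:
  assumes x: "x \<in> space M" "0 < r" and y: "y \<in> B x r" and s: "r \<le> s" "s \<le> 3 * \<kappa> * r"
  shows "avg y s \<le> D\<^sup>2 * avg x r"
proof -
  have k: "1 \<le> \<kappa>" by (rule one_le_constant)
  have ys: "y \<in> space M" "0 < s" using y x s qball_subset_space by auto
  have pos: "0 < \<kappa> * (r + s)" "0 < \<kappa> * (r + r)" using k x ys by (auto intro!: mult_pos_pos)
  have "measure \<nu> (B y s) \<le> measure \<nu> (B x (\<kappa> * (r + s)))"
    using x y ys pos by (intro measure_nu_mono qball_subset_qball) auto
  also have "\<dots> \<le> D * measure \<nu> (B x r)"
  proof (rule nu_dilate_le)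
    have "\<kappa> * (r + s) \<le> \<kappa> * (r + 3 * \<kappa> * r)" using k s by (intro mult_left_mono) auto
    then show "\<kappa> * (r + s) \<le> \<kappa> * (1 + 3 * \<kappa>) * r" by (simp add: algebra_simps)
  qed (use x pos in auto)
  finally have 1: "measure \<nu> (B y s) \<le> D * measure \<nu> (B x r)" .
  have "x \<in> B y r" using y x(1) ys(1) commute[of x y] by (simp add: qball_def)
  then have "B x r \<subseteq> B y (\<kappa> * (r + r))" using ys by (intro qball_subset_qball) auto
  then have "measure M (B x r) \<le> measure M (B y (\<kappa> * (r + r)))"
    using x ys pos by (intro measure_qball_mono) auto
  also have "\<dots> \<le> D * measure M (B y r)"
  proof (rule measure_dilate_le)
    have "\<kappa> * (r + r) = \<kappa> * 2 * r" by simp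
    also have "\<dots> \<le> \<kappa> * (1 + 3 * \<kappa>) * r" using k x by (intro mult_right_mono mult_left_mono) auto
    finally show "\<kappa> * (r + r) \<le> \<kappa> * (1 + 3 * \<kappa>) * r" .
  qed (use x ys k in auto)
  also have "\<dots> \<le> D * measure M (B y s)"
    using D x ys s by (intro mult_left_mono measure_qball_mono qball_mono) auto
  finally have 2: "measure M (B x r) \<le> D * measure M (B y s)" .
  have "avg y s \<le> D * measure \<nu> (B x r) / measure M (B y s)"
    unfolding avg_def using 1 by (intro divide_right_mono) auto
  also have "\<dots> \<le> D * measure \<nu> (B x r) / (measure M (B x r) / D)"
    using 2 D measure_qball_pos[OF x] measure_qball_pos[OF ys]
    by (intro divide_left_mono) (auto simp: field_simps)
  also have "\<dots> = D\<^sup>2 * avg x r" by (simp add: avg_def power2_eq_square)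
  finally show ?thesis .
qed

text \<open>Multiply the radius by \<open>3\<kappa>\<close> as long as the mean stays above \<open>l\<close>. The process stops while
  the radius is below \<open>r\<close>, because means at radii between \<open>r\<close> and \<open>3\<kappa>r\<close> are comparable with the
  mean over \<open>B x r\<close>.\<close>
lemma stopping_radius:
  assumes x: "x \<in> space M" "0 < r" and y: "y \<in> B x r" and l: "D\<^sup>2 * avg x r \<le> l"
    and s: "0 < s" "s < r" "l < avg y s"
  shows "\<exists>t. 0 < t \<and> t < r \<and> l < avg y t \<and> avg y (3 * \<kappa> * t) \<le> l"
proof (rule ccontr)
  assume neg: "\<not> ?thesis"
  have k: "1 \<le> \<kappa>" by (rule one_le_constant)
  have "(3 * \<kappa>) ^ n * s < r \<and> l < avg y ((3 * \<kappa>) ^ n * s)" for n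
  proof (induction n)
    case (Suc n)
    let ?t = "(3 * \<kappa>) ^ n * s"
    have "0 < ?t" using k s by simp
    then have big: "l < avg y (3 * \<kappa> * ?t)" using neg Suc by (auto simp: not_le)
    have "3 * \<kappa> * ?t < r"
    proof (rule ccontr)
      assume "\<not> 3 * \<kappa> * ?t < r"
      moreover have "3 * \<kappa> * ?t \<le> 3 * \<kappa> * r" using Suc k by (intro mult_left_mono) auto
      ultimately have "avg y (3 * \<kappa> * ?t) \<le> D\<^sup>2 * avg x r"
        using avg_comparison[OF x y, of "3 * \<kappa> * ?t"] by simp
      then show False using big l by simp
    qed
    then show ?case using big by (simp add: mult.assoc)
  qed (use s in simp)
  moreover obtain n where "r / s < (3 * \<kappa>) ^ n" using real_arch_pow[of "3 * \<kappa>" "r / s"] k by auto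
  ultimately show False using s by (smt (verit) divide_less_eq)
qed

lemma stopping_balls:
  assumes x: "x \<in> space M" "0 < r" and l: "D\<^sup>2 * avg x r \<le> l"
  obtains I t where "countable I" "disjoint_family_on (\<lambda>i. B i (t i)) I"
    "\<And>i. i \<in> I \<Longrightarrow> i \<in> B x r \<and> 0 < t i \<and> t i < r \<and> l < avg i (t i) \<and> avg i (3 * \<kappa> * t i) \<le> l"
    "{y \<in> B x r. \<exists>s. 0 < s \<and> s < r \<and> l < avg y s} \<subseteq> (\<Union>i\<in>I. B i (3 * \<kappa> * t i))"
proof -
  define S where "S = {y \<in> B x r. \<exists>s. 0 < s \<and> s < r \<and> l < avg y s}"
  have "\<forall>y\<in>S. \<exists>t. 0 < t \<and> t < r \<and> l < avg y t \<and> avg y (3 * \<kappa> * t) \<le> l"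
    using stopping_radius[OF x _ l] by (auto simp: S_def)
  then obtain t where t: "\<And>y. y \<in> S \<Longrightarrow> 0 < t y \<and> t y < r \<and> l < avg y (t y) \<and> avg y (3 * \<kappa> * t y) \<le> l"
    by metis
  have S: "S \<subseteq> space M" using qball_subset_space by (auto simp: S_def)
  have tr: "0 < t y \<and> t y \<le> r" if "y \<in> S" for y using t[OF that] by simp
  obtain I where I: "I \<subseteq> S" "disjoint_family_on (\<lambda>i. B i (t i)) I"
    "S \<subseteq> (\<Union>i\<in>I. B i (3 * \<kappa> * t i))" by (rule vitali_covering[OF S tr])
  have k: "1 \<le> \<kappa>" by (rule one_le_constant)
  have "countable I"
  proof (rule countable_disjoint_qballs[OF _ _ I(2), of "B x (\<kappa> * (r + r))"])
    show "B i (t i) \<subseteq> B x (\<kappa> * (r + r))" if "i \<in> I" for i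
    proof -
      have "B i (t i) \<subseteq> B x (\<kappa> * (r + t i))" using that I(1) x by (intro qball_subset_qball) (auto simp: S_def)
      also have "\<dots> \<subseteq> B x (\<kappa> * (r + r))" using t that I(1) k by (intro qball_mono mult_left_mono) (auto simp: less_imp_le)
      finally show ?thesis .
    qed
  qed (use S I t x k qball_measurable qball_finite in auto)
  moreover have "i \<in> B x r \<and> 0 < t i \<and> t i < r \<and> l < avg i (t i) \<and> avg i (3 * \<kappa> * t i) \<le> l" if "i \<in> I" for i
    using t[of i] that I(1) by (auto simp: S_def)
  ultimately show ?thesis using that[of I t] I by (simp add: S_def)
qed

text \<open>Here both stopping conditions enter: the dilated ball has mean at most \<open>l\<close>, which by the
  reverse Hoelder inequality controls its \<open>\<sigma>\<close>-mass by \<open>l\<^sup>p \<mu>(B\<^sub>i)\<close>, and the ball itself has mean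
  above \<open>l\<close>, which turns one factor \<open>l \<mu>(B\<^sub>i)\<close> into \<open>\<nu>\<close>-mass of the set \<open>{w > l/2}\<close>.\<close>
lemma stopping_balls_mass:
  assumes x: "x \<in> space M" "0 < r" and l: "0 < l" and I: "countable I" "disjoint_family_on (\<lambda>i. B i (t i)) I"
    and i: "\<And>i. i \<in> I \<Longrightarrow> i \<in> B x r \<and> 0 < t i \<and> t i < r \<and> l < avg i (t i) \<and> avg i (3 * \<kappa> * t i) \<le> l"
  shows "(\<integral>\<^sup>+i. emeasure \<sigma> (B i (3 * \<kappa> * t i)) \<partial>count_space I)
    \<le> ennreal (2 * C * D * l powr (p - 1) * measure \<nu> (B x (2 * \<kappa> * r) \<inter> superlevel (l / 2)))"
proof -
  let ?U = "superlevel (l / 2)"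
  define c where "c = 2 * C * D * l powr (p - 1)"
  have c: "0 \<le> c" using C D by (simp add: c_def)
  have k: "1 \<le> \<kappa>" by (rule one_le_constant)
  have im: "i \<in> space M" "0 < t i" "0 < 3 * \<kappa> * t i" if "i \<in> I" for i
    using i[OF that] qball_subset_space k by auto
  have meas: "B i (t i) \<inter> ?U \<in> sets M" if "i \<in> I" for i
    using im[OF that] qball_measurable by auto
  have fi: "B x (2 * \<kappa> * r) \<inter> ?U \<in> fmeasurable \<nu>"
    using x k nu_fmeasurable by (intro fmeasurable_Int_fmeasurable) auto
  have "emeasure \<sigma> (B i (3 * \<kappa> * t i)) \<le> ennreal c * emeasure \<nu> (B i (t i) \<inter> ?U)" if "i \<in> I" for i
  proof -
    note im = im[OF that] and i = i[OF that]
    have f: "B i (t i) \<inter> ?U \<in> fmeasurable \<nu>"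
      using im nu_fmeasurable by (intro fmeasurable_Int_fmeasurable) auto
    have "3 * \<kappa> * 1 \<le> (1 + 3 * \<kappa>) * \<kappa>" using k by (intro mult_mono) auto
    then have "3 * \<kappa> * t i \<le> \<kappa> * (1 + 3 * \<kappa>) * t i"
      using im by (intro mult_right_mono) (auto simp: mult.commute)
    then have m: "measure M (B i (3 * \<kappa> * t i)) \<le> D * measure M (B i (t i))"
      using im by (intro measure_dilate_le) auto
    have a: "avg i (3 * \<kappa> * t i) powr p \<le> l powr p"
      using p i avg_nonneg by (intro powr_mono2) auto
    have "C * measure M (B i (3 * \<kappa> * t i)) * avg i (3 * \<kappa> * t i) powr p
      \<le> C * (D * measure M (B i (t i))) * l powr p"
      using C D by (intro mult_mono m a order_refl) auto
    also have "\<dots> = C * D * l powr (p - 1) * (l * measure M (B i (t i)))"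
      using l by (simp add: powr_diff)
    also have "\<dots> \<le> C * D * l powr (p - 1) * (2 * measure \<nu> (B i (t i) \<inter> ?U))"
      using C D i by (intro mult_left_mono avg_le_imp_superlevel_mass im l) auto
    also have "\<dots> = c * measure \<nu> (B i (t i) \<inter> ?U)" by (simp add: c_def)
    finally have "emeasure \<sigma> (B i (3 * \<kappa> * t i)) \<le> ennreal (c * measure \<nu> (B i (t i) \<inter> ?U))"
      using reverse_hoelder[OF im(1,3)] by (meson ennreal_leI order_trans)
    then show ?thesis using f c by (simp add: emeasure_eq_measure2 ennreal_mult')
  qed
  then have "(\<integral>\<^sup>+i. emeasure \<sigma> (B i (3 * \<kappa> * t i)) \<partial>count_space I)
    \<le> (\<integral>\<^sup>+i. ennreal c * emeasure \<nu> (B i (t i) \<inter> ?U) \<partial>count_space I)"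
    by (intro nn_integral_mono) auto
  also have "\<dots> = ennreal c * (\<integral>\<^sup>+i. emeasure \<nu> (B i (t i) \<inter> ?U) \<partial>count_space I)"
    by (intro nn_integral_cmult) auto
  also have "(\<integral>\<^sup>+i. emeasure \<nu> (B i (t i) \<inter> ?U) \<partial>count_space I) = emeasure \<nu> (\<Union>i\<in>I. B i (t i) \<inter> ?U)"
    using I meas by (intro emeasure_UN_countable[symmetric]) (auto simp: disjoint_family_on_def)
  also have "\<dots> \<le> emeasure \<nu> (B x (2 * \<kappa> * r) \<inter> ?U)"
  proof (rule emeasure_mono)
    have "B i (t i) \<subseteq> B x (2 * \<kappa> * r)" if "i \<in> I" for i
    proof -
      have "B i (t i) \<subseteq> B x (\<kappa> * (r + t i))" using i[OF that] x by (intro qball_subset_qball) auto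
      also have "\<dots> \<subseteq> B x (\<kappa> * (r + r))" using i[OF that] k by (intro qball_mono mult_left_mono) auto
      finally show ?thesis by (simp add: mult.assoc mult.left_commute)
    qed
    then show "(\<Union>i\<in>I. B i (t i) \<inter> ?U) \<subseteq> B x (2 * \<kappa> * r) \<inter> ?U" by auto
  qed (use x k qball_measurable in auto)
  also have "ennreal c * emeasure \<nu> (B x (2 * \<kappa> * r) \<inter> ?U)
      = ennreal (c * measure \<nu> (B x (2 * \<kappa> * r) \<inter> ?U))"
    using fi c by (simp add: emeasure_eq_measure2 ennreal_mult')
  finally show ?thesis by (auto simp: c_def mult_left_mono)
qed

end

section \<open>Exponential decay of superlevel sets\<close>

text \<open>The sum is geometric and hence comparable with its largest term, which is below \<open>v\<^sup>q\<close>.\<close>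
lemma sum_powr_dyadic_levels:
  fixes q l v :: real
  assumes q: "0 < q" and l: "0 < l"
  shows "(\<Sum>k<N. if l * 2 ^ k < v then (l * 2 ^ k) powr q else 0)
    \<le> 2 powr q / (2 powr q - 1) * v powr q"
proof (induction N)
  case 0
  have "1 < 2 powr q" using q by simp
  then show ?case by simp
next
  case (Suc N)
  define Q where "Q = 2 powr q"
  have Q: "1 < Q" using q by (simp add: Q_def)
  show ?case
  proof (cases "l * 2 ^ N < v")
    case True
    have lev: "(l * 2 ^ k) powr q = l powr q * Q ^ k" for k
    proof -
      have "(2 ^ k) powr q = Q ^ k"
        by (simp add: Q_def powr_realpow[symmetric] powr_powr mult.commute)
      then show ?thesis using l by (simp add: powr_mult)
    qed
    have "(\<Sum>k<Suc N. if l * 2 ^ k < v then (l * 2 ^ k) powr q else 0) \<le> (\<Sum>k<Suc N. l powr q * Q ^ k)"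
      using Q by (intro sum_mono) (auto simp: lev)
    also have "\<dots> = l powr q * ((Q ^ Suc N - 1) / (Q - 1))"
      using Q by (subst geometric_sum[symmetric]) (simp, simp only: sum_distrib_left)
    also have "\<dots> \<le> l powr q * (Q ^ Suc N / (Q - 1))"
      using Q by (intro mult_left_mono divide_right_mono) auto
    also have "\<dots> = Q / (Q - 1) * (l * 2 ^ N) powr q" by (simp add: lev)
    also have "\<dots> \<le> Q / (Q - 1) * v powr q"
      using Q l q True by (intro mult_left_mono powr_mono2) auto
    finally show ?thesis by (simp add: Q_def)
  qed (use Suc in simp)
qed

context reverse_hoelder_space
begin

text \<open>Pointwise, the levels \<open>l 2\<^sup>k\<close> below \<open>2 w\<close> contribute a geometric sum comparable with
  \<open>w\<^sup>p\<^sup>-\<^sup>1 w = w\<^sup>p\<close>. The bound does not depend on the number \<open>N\<close> of levels, which is what makes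
  the pigeonhole argument in the next covering lemma possible.\<close>
lemma dyadic_levels_mass:
  assumes x: "x \<in> space M" "0 < R" and l: "0 < l"
  shows "(\<Sum>k<N. (l * 2 ^ k) powr (p - 1) * measure \<nu> (B x R \<inter> superlevel (l * 2 ^ k / 2)))
    \<le> 2 powr (p - 1) / (2 powr (p - 1) - 1) * 2 powr (p - 1) * measure \<sigma> (B x R)"
proof -
  define G where "G = 2 powr (p - 1) / (2 powr (p - 1) - 1) * 2 powr (p - 1)"
  have "1 < 2 powr (p - 1)" using p by simp
  then have G: "0 \<le> G" by (simp add: G_def)
  let ?U = "\<lambda>k::nat. superlevel (l * 2 ^ k / 2)"
  have [measurable]: "B x R \<in> sets M" using x by (rule qball_measurable)
  have f: "B x R \<inter> ?U k \<in> fmeasurable \<nu>" for k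
    using nu_fmeasurable[OF x] by (intro fmeasurable_Int_fmeasurable) auto
  have "ennreal (\<Sum>k<N. (l * 2 ^ k) powr (p - 1) * measure \<nu> (B x R \<inter> ?U k))
    = (\<Sum>k<N. ennreal ((l * 2 ^ k) powr (p - 1)) * emeasure \<nu> (B x R \<inter> ?U k))"
    using f by (simp add: sum_ennreal[symmetric] emeasure_eq_measure2 ennreal_mult')
  also have "\<dots> = (\<Sum>k<N. \<integral>\<^sup>+y. ennreal ((l * 2 ^ k) powr (p - 1)) * (ennreal (w y) * indicator (B x R \<inter> ?U k) y) \<partial>M)"
    by (simp add: emeasure_nu nn_integral_cmult)
  also have "\<dots> = (\<integral>\<^sup>+y. (\<Sum>k<N. ennreal ((l * 2 ^ k) powr (p - 1)) * (ennreal (w y) * indicator (B x R \<inter> ?U k) y)) \<partial>M)"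
    by (intro nn_integral_sum[symmetric]) measurable
  also have "\<dots> \<le> (\<integral>\<^sup>+y. ennreal G * (ennreal (w y powr p) * indicator (B x R) y) \<partial>M)"
  proof (rule nn_integral_mono)
    fix y assume y: "y \<in> space M"
    have w0: "0 \<le> w y" using w_nonneg[OF y] .
    show "(\<Sum>k<N. ennreal ((l * 2 ^ k) powr (p - 1)) * (ennreal (w y) * indicator (B x R \<inter> ?U k) y))
      \<le> ennreal G * (ennreal (w y powr p) * indicator (B x R) y)"
    proof (cases "y \<in> B x R")
      case True
      have "(\<Sum>k<N. ennreal ((l * 2 ^ k) powr (p - 1)) * (ennreal (w y) * indicator (B x R \<inter> ?U k) y))
        = (\<Sum>k<N. ennreal ((if l * 2 ^ k < 2 * w y then (l * 2 ^ k) powr (p - 1) else 0) * w y))"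
        using True y w0 by (intro sum.cong) (auto simp: superlevel_def ennreal_mult' split: split_indicator)
      also have "\<dots> = ennreal ((\<Sum>k<N. if l * 2 ^ k < 2 * w y then (l * 2 ^ k) powr (p - 1) else 0) * w y)"
        using w0 by (subst sum_ennreal) (auto simp: sum_distrib_right)
      also have "\<dots> \<le> ennreal (2 powr (p - 1) / (2 powr (p - 1) - 1) * (2 * w y) powr (p - 1) * w y)"
        using p l w0 by (intro ennreal_leI mult_right_mono sum_powr_dyadic_levels) auto
      also have "2 powr (p - 1) / (2 powr (p - 1) - 1) * (2 * w y) powr (p - 1) * w y = G * w y powr p"
        using w0 p by (cases "w y = 0") (auto simp: G_def powr_mult powr_diff)
      finally show ?thesis using True G by (simp add: ennreal_mult')
    qed simp
  qed
  also have "\<dots> = ennreal G * emeasure \<sigma> (B x R)"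
    by (simp add: nn_integral_cmult emeasure_sigma)
  also have "\<dots> = ennreal (G * measure \<sigma> (B x R))"
    using G sigma_fmeasurable[OF x] by (simp add: emeasure_eq_measure2 ennreal_mult')
  finally have "(\<Sum>k<N. (l * 2 ^ k) powr (p - 1) * measure \<nu> (B x R \<inter> ?U k)) \<le> G * measure \<sigma> (B x R)"
    using G by (simp add: ennreal_le_iff)
  then show ?thesis by (simp add: G_def)
qed

text \<open>\<open>\<sigma>\<close> inherits doubling from \<open>\<mu>\<close> and \<open>\<nu>\<close>, as \<open>\<sigma>(B)\<close> is comparable with \<open>\<mu>(B) a(B)\<^sup>p\<close> by the
  reverse Hoelder inequality in one direction and Jensen's inequality in the other.\<close>
lemma sigma_dilate:
  assumes x: "x \<in> space M" "0 < r"
  shows "measure \<sigma> (B x (2 * \<kappa> * r)) \<le> C * D * D powr p * 2 powr p * measure \<sigma> (B x r)"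
proof -
  have k: "1 \<le> \<kappa>" by (rule one_le_constant)
  have r: "0 < 2 * \<kappa> * r" using k x by simp
  have "2 * \<kappa> * r = \<kappa> * 2 * r" by simp
  also have "\<dots> \<le> \<kappa> * (1 + 3 * \<kappa>) * r" using k x by (intro mult_right_mono mult_left_mono) auto
  finally have le: "2 * \<kappa> * r \<le> \<kappa> * (1 + 3 * \<kappa>) * r" .
  have m: "measure M (B x (2 * \<kappa> * r)) \<le> D * measure M (B x r)"
    using x r le by (intro measure_dilate_le)
  have n: "measure \<nu> (B x (2 * \<kappa> * r)) \<le> D * measure \<nu> (B x r)"
    using x r le by (intro nu_dilate_le)
  have "1 * r \<le> 2 * \<kappa> * r" using k x by (intro mult_right_mono) auto
  then have m': "measure M (B x r) \<le> measure M (B x (2 * \<kappa> * r))"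
    using x r by (intro measure_qball_mono qball_mono) auto
  have "avg x (2 * \<kappa> * r) \<le> D * measure \<nu> (B x r) / measure M (B x r)"
    unfolding avg_def using n m' D measure_qball_pos[OF x] by (intro frac_le) auto
  then have a: "avg x (2 * \<kappa> * r) \<le> D * avg x r" by (simp add: avg_def)
  have "ennreal (measure \<sigma> (B x (2 * \<kappa> * r))) \<le> ennreal (C * measure M (B x (2 * \<kappa> * r)) * avg x (2 * \<kappa> * r) powr p)"
    using reverse_hoelder[OF x(1) r] sigma_fmeasurable[OF x(1) r] by (simp add: emeasure_eq_measure2)
  then have "measure \<sigma> (B x (2 * \<kappa> * r)) \<le> C * measure M (B x (2 * \<kappa> * r)) * avg x (2 * \<kappa> * r) powr p"
    using C by (simp add: ennreal_le_iff)
  also have "\<dots> \<le> C * (D * measure M (B x r)) * (D * avg x r) powr p"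
    using C D p a avg_nonneg by (intro mult_mono m order_refl powr_mono2) auto
  also have "\<dots> = C * D * D powr p * (avg x r powr p * measure M (B x r))"
    using D avg_nonneg by (simp add: powr_mult)
  also have "\<dots> \<le> C * D * D powr p * (2 powr p * measure \<sigma> (B x r))"
    using C D by (intro mult_left_mono avg_powr_le_sigma x) auto
  finally show ?thesis by (simp add: mult.assoc)
qed

text \<open>The stopping balls at the levels \<open>D\<^sup>2 a(B) 2\<^sup>k\<close>, \<open>k < N\<close>, have \<open>\<sigma>\<close>-masses whose sum over
  all levels is bounded by a multiple of \<open>\<sigma>(B)\<close> independent of \<open>N\<close>; if \<open>N\<close> exceeds twice this
  multiple, one level has mass at most \<open>\<sigma>(B)/2\<close>. This level varies with the ball, but it is at
  most \<open>L a(B) / 2\<close> with the fixed \<open>L = 2 D\<^sup>2 2\<^sup>N\<close>. The factor \<open>2\<close> provides the gap between the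
  level and the values of \<open>w\<close> that the differentiation theorem requires.\<close>
lemma halving_cover:
  obtains L where "2 \<le> L" "\<And>x r. x \<in> space M \<Longrightarrow> 0 < r \<Longrightarrow>
    \<exists>I t Z. countable I \<and> I \<subseteq> space M \<and> (\<forall>i\<in>I. 0 < t i \<and> avg i (t i) \<le> L * avg x r) \<and> Z \<in> null_sets M \<and>
      {y \<in> B x r. L * avg x r < w y} \<subseteq> Z \<union> (\<Union>i\<in>I. B i (t i)) \<and>
      (\<integral>\<^sup>+i. emeasure \<sigma> (B i (t i)) \<partial>count_space I) \<le> ennreal (1 / 2) * emeasure \<sigma> (B x r)"
proof -
  have k: "1 \<le> \<kappa>" by (rule one_le_constant)
  define G where "G = 2 powr (p - 1) / (2 powr (p - 1) - 1) * 2 powr (p - 1)"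
  have "1 < 2 powr (p - 1)" using p by simp
  then have G: "0 \<le> G" by (simp add: G_def)
  define c where "c = 2 * C * D"
  define c' where "c' = C * D * D powr p * 2 powr p"
  have c: "0 \<le> c" "0 \<le> c'" using C D by (auto simp: c_def c'_def)
  obtain N :: nat where N: "2 * (c * (G * c')) < N" using reals_Archimedean2 by blast
  then have N0: "0 < N" using c G by (cases "N = 0") (auto simp: mult_less_0_iff)
  define L where "L = 2 * (D\<^sup>2 * 2 ^ N)"
  have D2: "1 \<le> D\<^sup>2" using D by (simp add: one_le_power)
  have "1 * 1 \<le> D\<^sup>2 * 2 ^ N" using D2 by (intro mult_mono) auto
  then have L: "2 \<le> L" by (simp add: L_def)
  have "\<exists>I t Z. countable I \<and> I \<subseteq> space M \<and> (\<forall>i\<in>I. 0 < t i \<and> avg i (t i) \<le> L * avg x r) \<and> Z \<in> null_sets M \<and>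
      {y \<in> B x r. L * avg x r < w y} \<subseteq> Z \<union> (\<Union>i\<in>I. B i (t i)) \<and>
      (\<integral>\<^sup>+i. emeasure \<sigma> (B i (t i)) \<partial>count_space I) \<le> ennreal (1 / 2) * emeasure \<sigma> (B x r)"
    if x: "x \<in> space M" "0 < r" for x r
  proof (cases "avg x r = 0")
    \<comment> \<open>If the mean vanishes there are no positive levels to choose from, but then \<open>w\<close> vanishes
      almost everywhere on the ball and the empty cover works.\<close>
    case True
    have [measurable]: "B x r \<in> sets M" using x by (rule qball_measurable)
    have "emeasure \<nu> (B x r) = ennreal (measure \<nu> (B x r))"
      using nu_fmeasurable[OF x] by (simp add: emeasure_eq_measure2)
    then have "(\<integral>\<^sup>+y. ennreal (w y) * indicator (B x r) y \<partial>M) = 0"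
      using True measure_nu_eq[OF x] by (simp add: emeasure_nu)
    then have "{y \<in> space M. ennreal (w y) * indicator (B x r) y \<noteq> 0} \<in> null_sets M"
      by (subst (asm) nn_integral_0_iff) (auto simp: null_sets_def)
    moreover have "{y \<in> B x r. L * avg x r < w y} \<subseteq> {y \<in> space M. ennreal (w y) * indicator (B x r) y \<noteq> 0}"
      using True qball_subset_space[of x r] by (auto simp: ennreal_eq_0_iff)
    ultimately show ?thesis by (intro exI[of _ "{}"] exI) (auto simp: nn_integral_empty)
  next
    case False
    define a where "a = avg x r"
    have a: "0 < a" using False avg_nonneg[of x r] by (simp add: a_def)
    define l where "l = D\<^sup>2 * a"
    have l: "0 < l" using a D by (auto simp: l_def)
    have r': "0 < 2 * \<kappa> * r" using k x by simp
    define h where "h k = (l * 2 ^ k) powr (p - 1) * measure \<nu> (B x (2 * \<kappa> * r) \<inter> superlevel (l * 2 ^ k / 2))" for k :: nat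
    have "\<exists>k<N. c * h k \<le> 1 / 2 * measure \<sigma> (B x r)"
    proof (rule ccontr)
      assume "\<not> ?thesis"
      then have "(\<Sum>k<N. 1 / 2 * measure \<sigma> (B x r)) < (\<Sum>k<N. c * h k)"
        using N0 by (intro sum_strict_mono) auto
      then have "N * (1 / 2 * measure \<sigma> (B x r)) < c * (\<Sum>k<N. h k)"
        by (simp add: sum_distrib_left)
      also have "\<dots> \<le> c * (G * measure \<sigma> (B x (2 * \<kappa> * r)))"
        using dyadic_levels_mass[OF x(1) r' l] c by (intro mult_left_mono) (simp_all add: h_def G_def)
      also have "\<dots> \<le> c * (G * (c' * measure \<sigma> (B x r)))"
        using sigma_dilate[OF x] c G by (intro mult_left_mono) (simp_all add: c'_def)
      also have "\<dots> = c * (G * c') * measure \<sigma> (B x r)" by simp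
      also have "\<dots> \<le> N / 2 * measure \<sigma> (B x r)" using N by (intro mult_right_mono) auto
      finally show False by simp
    qed
    then obtain k where k': "k < N" "c * h k \<le> 1 / 2 * measure \<sigma> (B x r)" by blast
    define l' where "l' = l * 2 ^ k"
    have "(1::real) \<le> 2 ^ k" "(2::real) ^ k \<le> 2 ^ N" using k'(1) by auto
    then have "l * 1 \<le> l * 2 ^ k" "l * 2 ^ k \<le> l * 2 ^ N"
      using l by (auto intro!: mult_left_mono simp del: mult_1_right)
    then have l': "0 < l'" "l \<le> l'" "2 * l' \<le> L * a"
      using l by (auto simp: l'_def l_def L_def mult_ac)
    obtain I t where It: "countable I" "disjoint_family_on (\<lambda>i. B i (t i)) I"
      "\<And>i. i \<in> I \<Longrightarrow> i \<in> B x r \<and> 0 < t i \<and> t i < r \<and> l' < avg i (t i) \<and> avg i (3 * \<kappa> * t i) \<le> l'"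
      "{y \<in> B x r. \<exists>s. 0 < s \<and> s < r \<and> l' < avg y s} \<subseteq> (\<Union>i\<in>I. B i (3 * \<kappa> * t i))"
      using stopping_balls[OF x, of l'] l' by (auto simp: l_def a_def)
    obtain Z where Z: "Z \<in> null_sets M" "{y\<in>B x r. 2 * l' < w y \<and> (\<forall>s. 0 < s \<and> s < r \<longrightarrow>
      emeasure \<nu> (B y s) \<le> ennreal (l' * measure M (B y s)))} \<subseteq> Z"
      using exceeding_small_averages_null[OF semiregular x w_measurable, of l' "2 * l'" r] l' x
      unfolding \<nu>_def by auto
    have cover: "{y \<in> B x r. L * avg x r < w y} \<subseteq> Z \<union> (\<Union>i\<in>I. B i (3 * \<kappa> * t i))"
    proof
      fix y assume "y \<in> {y \<in> B x r. L * avg x r < w y}"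
      then have y: "y \<in> B x r" "2 * l' < w y" using l'(3) by (auto simp: a_def)
      then have ym: "y \<in> space M" using qball_subset_space by auto
      show "y \<in> Z \<union> (\<Union>i\<in>I. B i (3 * \<kappa> * t i))"
      proof (cases "\<exists>s. 0 < s \<and> s < r \<and> l' < avg y s")
        case True
        then show ?thesis using It(4) y by auto
      next
        case False
        have "emeasure \<nu> (B y s) \<le> ennreal (l' * measure M (B y s))" if s: "0 < s" "s < r" for s
        proof -
          have "avg y s \<le> l'" using False s by (meson not_less)
          then show ?thesis using nu_fmeasurable[OF ym s(1)] measure_nu_eq[OF ym s(1)]
            by (auto simp: emeasure_eq_measure2 intro!: ennreal_leI mult_right_mono)
        qed
        then show ?thesis using Z(2) y by auto
      qed
    qed
    have "(\<integral>\<^sup>+i. emeasure \<sigma> (B i (3 * \<kappa> * t i)) \<partial>count_space I) \<le> ennreal (c * h k)"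
      using stopping_balls_mass[OF x l'(1) It(1,2,3)] by (simp add: c_def h_def l'_def mult.assoc)
    also have "\<dots> \<le> ennreal (1 / 2 * measure \<sigma> (B x r))" using k'(2) by (rule ennreal_leI)
    also have "\<dots> = ennreal (1 / 2) * emeasure \<sigma> (B x r)"
      using sigma_fmeasurable[OF x] by (subst ennreal_mult') (auto simp: emeasure_eq_measure2)
    finally have mass: "(\<integral>\<^sup>+i. emeasure \<sigma> (B i (3 * \<kappa> * t i)) \<partial>count_space I) \<le> ennreal (1 / 2) * emeasure \<sigma> (B x r)" .
    have I: "I \<subseteq> space M" using It(3) qball_subset_space by auto
    have "\<forall>i\<in>I. 0 < 3 * \<kappa> * t i \<and> avg i (3 * \<kappa> * t i) \<le> L * avg x r"
    proof
      fix i assume "i \<in> I"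
      from It(3)[OF this] show "0 < 3 * \<kappa> * t i \<and> avg i (3 * \<kappa> * t i) \<le> L * avg x r"
        using k l' by (auto simp: a_def)
    qed
    then show ?thesis using It(1) I Z(1) cover mass
      by (intro exI[of _ I] exI[of _ "\<lambda>i. 3 * \<kappa> * t i"] exI[of _ Z]) simp
  qed
  then show ?thesis using that L by blast
qed

text \<open>Induction over \<open>m\<close> for all balls at once: on a ball of the halving cover, being above
  \<open>L\<^sup>m\<^sup>+\<^sup>1\<close> times the old mean implies being above \<open>L\<^sup>m\<close> times the new one.\<close>
lemma superlevel_decay:
  obtains L where "2 \<le> L" "\<And>m x r. x \<in> space M \<Longrightarrow> 0 < r \<Longrightarrow>
    emeasure \<sigma> (B x r \<inter> superlevel (L ^ m * avg x r)) \<le> ennreal ((1 / 2) ^ m) * emeasure \<sigma> (B x r)"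
proof -
  obtain L where L: "2 \<le> L" and cover: "\<And>x r. x \<in> space M \<Longrightarrow> 0 < r \<Longrightarrow>
    \<exists>I t Z. countable I \<and> I \<subseteq> space M \<and> (\<forall>i\<in>I. 0 < t i \<and> avg i (t i) \<le> L * avg x r) \<and> Z \<in> null_sets M \<and>
      {y \<in> B x r. L * avg x r < w y} \<subseteq> Z \<union> (\<Union>i\<in>I. B i (t i)) \<and>
      (\<integral>\<^sup>+i. emeasure \<sigma> (B i (t i)) \<partial>count_space I) \<le> ennreal (1 / 2) * emeasure \<sigma> (B x r)"
    using halving_cover by blast
  have "emeasure \<sigma> (B x r \<inter> superlevel (L ^ m * avg x r)) \<le> ennreal ((1 / 2) ^ m) * emeasure \<sigma> (B x r)"
    if "x \<in> space M" "0 < r" for m x r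
    using that
  proof (induction m arbitrary: x r)
    case 0
    then show ?case using qball_measurable by (auto intro: emeasure_mono)
  next
    case (Suc m)
    note x = Suc.prems
    let ?E = "\<lambda>i s. B i s \<inter> superlevel (L ^ m * avg i s)"
    obtain I t Z where I: "countable I" "I \<subseteq> space M" "\<forall>i\<in>I. 0 < t i \<and> avg i (t i) \<le> L * avg x r"
      "Z \<in> null_sets M" "{y \<in> B x r. L * avg x r < w y} \<subseteq> Z \<union> (\<Union>i\<in>I. B i (t i))"
      "(\<integral>\<^sup>+i. emeasure \<sigma> (B i (t i)) \<partial>count_space I) \<le> ennreal (1 / 2) * emeasure \<sigma> (B x r)"
      using cover[OF x] by blast
    have i: "i \<in> space M" "0 < t i" "avg i (t i) \<le> L * avg x r" if "i \<in> I" for i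
      using I(2,3) that by auto
    have meas: "?E i (t i) \<in> sets M" if "i \<in> I" for i using i[OF that] qball_measurable by auto
    have UN: "(\<Union>i\<in>I. ?E i (t i)) \<in> sets M" using I(1) meas by (intro sets.countable_UN') auto
    have "AE y in M. ennreal (w y powr p) * indicator Z y = 0"
      using AE_not_in[OF I(4)] by eventually_elim simp
    then have Z: "Z \<in> null_sets \<sigma>"
      using I(4) AE_not_in[OF I(4)] by (auto simp: \<sigma>_def null_sets_density_iff)
    have sub: "B x r \<inter> superlevel (L ^ Suc m * avg x r) \<subseteq> (\<Union>i\<in>I. ?E i (t i)) \<union> Z"
    proof
      fix y assume "y \<in> B x r \<inter> superlevel (L ^ Suc m * avg x r)"
      then have y: "y \<in> B x r" "y \<in> space M" "L ^ Suc m * avg x r < w y" by (auto simp: superlevel_def)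
      have "1 * (L * avg x r) \<le> L ^ m * (L * avg x r)"
        using L avg_nonneg[of x r] by (intro mult_right_mono one_le_power) auto
      then have "y \<in> Z \<union> (\<Union>i\<in>I. B i (t i))" using y I(5) by (auto simp: mult.assoc mult.left_commute)
      moreover have "y \<in> ?E j (t j)" if j: "j \<in> I" "y \<in> B j (t j)" for j
      proof -
        have "L ^ m * avg j (t j) \<le> L ^ m * (L * avg x r)" using i(3)[OF j(1)] L by (intro mult_left_mono) auto
        then show ?thesis using y j by (auto simp: superlevel_def mult.assoc mult.left_commute)
      qed
      ultimately show "y \<in> (\<Union>i\<in>I. ?E i (t i)) \<union> Z" by auto
    qed
    have "emeasure \<sigma> (B x r \<inter> superlevel (L ^ Suc m * avg x r)) \<le> emeasure \<sigma> ((\<Union>i\<in>I. ?E i (t i)) \<union> Z)"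
      using sub UN I(4) by (intro emeasure_mono) auto
    also have "\<dots> = emeasure \<sigma> (\<Union>i\<in>I. ?E i (t i))"
      using UN Z by (intro emeasure_Un_null_set) auto
    also have "\<dots> \<le> (\<integral>\<^sup>+i. emeasure \<sigma> (?E i (t i)) \<partial>count_space I)"
      using I(1) meas by (intro emeasure_UN_le_count_space) auto
    also have "\<dots> \<le> (\<integral>\<^sup>+i. ennreal ((1 / 2) ^ m) * emeasure \<sigma> (B i (t i)) \<partial>count_space I)"
      using Suc.IH i by (intro nn_integral_mono) auto
    also have "\<dots> = ennreal ((1 / 2) ^ m) * (\<integral>\<^sup>+i. emeasure \<sigma> (B i (t i)) \<partial>count_space I)"
      by (intro nn_integral_cmult) auto
    also have "\<dots> \<le> ennreal ((1 / 2) ^ m) * (ennreal (1 / 2) * emeasure \<sigma> (B x r))"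
      by (intro mult_left_mono I(6)) auto
    also have "\<dots> = ennreal ((1 / 2) ^ Suc m) * emeasure \<sigma> (B x r)"
    proof -
      have "ennreal ((1 / 2) ^ Suc m) = ennreal ((1 / 2) ^ m) * ennreal (1 / 2)"
        by (subst power_Suc2, rule ennreal_mult) auto
      then show ?thesis by (simp only: mult.assoc)
    qed
    finally show ?case .
  qed
  then show ?thesis using that L by blast
qed

section \<open>Higher integrability\<close>

text \<open>Where \<open>w \<le> a\<close>, the factor \<open>w\<^sup>\<epsilon>\<close> is at most \<open>a\<^sup>\<epsilon>\<close>; where
  \<open>L\<^sup>m a < w \<le> L\<^sup>m\<^sup>+\<^sup>1 a\<close>, it is at most \<open>(3/2)\<^sup>m\<^sup>+\<^sup>1 a\<^sup>\<epsilon>\<close>, and \<open>\<sigma>\<close> gives this set a mass of at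
  most \<open>2\<^sup>-\<^sup>m \<sigma>(B)\<close>. The constant is \<open>7 = 1 + (3/2) / (1 - 3/4)\<close>.\<close>
lemma higher_integrability:
  obtains \<epsilon> where "0 < \<epsilon>" "\<And>x r. x \<in> space M \<Longrightarrow> 0 < r \<Longrightarrow>
    (\<integral>\<^sup>+y. ennreal (w y powr (p + \<epsilon>)) * indicator (B x r) y \<partial>M)
      \<le> ennreal (7 * C * measure M (B x r) * avg x r powr (p + \<epsilon>))"
proof -
  obtain L where L: "2 \<le> L" and decay: "\<And>m x r. x \<in> space M \<Longrightarrow> 0 < r \<Longrightarrow>
    emeasure \<sigma> (B x r \<inter> superlevel (L ^ m * avg x r)) \<le> ennreal ((1 / 2) ^ m) * emeasure \<sigma> (B x r)"
    using superlevel_decay by blast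
  define \<epsilon> where "\<epsilon> = ln (3 / 2) / ln L"
  have \<epsilon>: "0 < \<epsilon>" using L by (simp add: \<epsilon>_def)
  have "L powr \<epsilon> = 3 / 2" using L by (simp add: powr_def \<epsilon>_def)
  have L\<epsilon>: "(L ^ m) powr \<epsilon> = (3 / 2) ^ m" for m
  proof -
    have "(L ^ m) powr \<epsilon> = (L powr \<epsilon>) powr real m"
      using L by (simp add: powr_realpow[symmetric] powr_powr mult.commute)
    also have "\<dots> = (3 / 2) ^ m" unfolding \<open>L powr \<epsilon> = 3 / 2\<close> by (simp add: powr_realpow)
    finally show ?thesis .
  qed
  have "(\<integral>\<^sup>+y. ennreal (w y powr (p + \<epsilon>)) * indicator (B x r) y \<partial>M)
      \<le> ennreal (7 * C * measure M (B x r) * avg x r powr (p + \<epsilon>))"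
    if x: "x \<in> space M" "0 < r" for x r
  proof (cases "avg x r = 0")
    case True
    have [measurable]: "B x r \<in> sets M" using x by (rule qball_measurable)
    have "(\<integral>\<^sup>+y. ennreal (w y powr p) * indicator (B x r) y \<partial>M) = 0"
      using reverse_hoelder[OF x] True p by (simp add: emeasure_sigma)
    then have "AE y in M. ennreal (w y powr p) * indicator (B x r) y = 0"
      by (subst (asm) nn_integral_0_iff_AE) auto
    then have "AE y in M. ennreal (w y powr (p + \<epsilon>)) * indicator (B x r) y = 0"
      by eventually_elim (auto split: split_indicator)
    then show ?thesis by (subst nn_integral_cong_AE[where v = "\<lambda>_. 0"]) auto
  next
    case False
    define a where "a = avg x r"
    have a: "0 < a" using False avg_nonneg[of x r] by (simp add: a_def)
    have [measurable]: "B x r \<in> sets M" using x by (rule qball_measurable)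
    let ?U = "\<lambda>m::nat. superlevel (L ^ m * a)"
    let ?f = "\<lambda>y. ennreal (w y powr p) * indicator (B x r) y"
    let ?g = "\<lambda>m y. ennreal ((3 / 2) ^ Suc m) * (ennreal (w y powr p) * indicator (B x r \<inter> ?U m) y)"
    have "(\<integral>\<^sup>+y. ennreal (w y powr (p + \<epsilon>)) * indicator (B x r) y \<partial>M)
      \<le> (\<integral>\<^sup>+y. ennreal (a powr \<epsilon>) * (?f y + (\<Sum>m. ?g m y)) \<partial>M)"
    proof (rule nn_integral_mono)
      fix y assume y: "y \<in> space M"
      have w0: "0 \<le> w y" using w_nonneg[OF y] .
      show "ennreal (w y powr (p + \<epsilon>)) * indicator (B x r) y \<le> ennreal (a powr \<epsilon>) * (?f y + (\<Sum>m. ?g m y))"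
      proof (cases "y \<in> B x r")
        case yB: True
        have bound: "ennreal (w y powr (p + \<epsilon>)) \<le> ennreal (a powr \<epsilon>) * (ennreal ((3 / 2) ^ n) * ennreal (w y powr p))"
          if "w y \<le> L ^ n * a" for n
        proof -
          have "w y powr \<epsilon> \<le> (L ^ n * a) powr \<epsilon>" using that w0 \<epsilon> by (intro powr_mono2) auto
          also have "\<dots> = (3 / 2) ^ n * a powr \<epsilon>" using L a by (simp add: powr_mult L\<epsilon>)
          finally have "w y powr p * w y powr \<epsilon> \<le> w y powr p * ((3 / 2) ^ n * a powr \<epsilon>)"
            by (intro mult_left_mono) auto
          then have "w y powr (p + \<epsilon>) \<le> a powr \<epsilon> * ((3 / 2) ^ n * w y powr p)"
            by (simp add: powr_add mult_ac)
          then show ?thesis by (simp add: ennreal_mult'[symmetric] ennreal_leI)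
        qed
        show ?thesis
        proof (cases "w y \<le> a")
          case True
          have "ennreal (w y powr (p + \<epsilon>)) \<le> ennreal (a powr \<epsilon>) * ennreal (w y powr p)"
            using bound[of 0] True by simp
          also have "\<dots> \<le> ennreal (a powr \<epsilon>) * (?f y + (\<Sum>m. ?g m y))"
            using yB by (intro mult_left_mono) auto
          finally show ?thesis using yB by simp
        next
          case False
          have "\<exists>n. w y \<le> L ^ n * a"
          proof -
            obtain n where "w y / a < L ^ n" using real_arch_pow[of L "w y / a"] L by auto
            then show ?thesis using a by (intro exI[of _ n]) (simp add: field_simps)
          qed
          \<comment> \<open>The least such \<open>n\<close> is positive because \<open>w y > a\<close>, so its predecessor is the layer
            that contains \<open>y\<close>.\<close>
          then obtain n where n: "w y \<le> L ^ n * a" "\<And>k. k < n \<Longrightarrow> \<not> w y \<le> L ^ k * a"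
            using exists_least_iff[of "\<lambda>n. w y \<le> L ^ n * a"] by blast
          then obtain m where m: "n = Suc m" using False by (cases n) auto
          have "ennreal (w y powr (p + \<epsilon>)) \<le> ennreal (a powr \<epsilon>) * ?g m y"
            using bound[OF n(1)] n(2)[of m] yB y m by (auto simp: superlevel_def not_le)
          also have "?g m y \<le> (\<Sum>m. ?g m y)"
            using sum_le_suminf[OF summableI, of "{m}" "\<lambda>m. ?g m y"] by simp
          also have "\<dots> \<le> ?f y + (\<Sum>m. ?g m y)" by simp
          finally show ?thesis using yB by (simp add: mult_left_mono)
        qed
      qed simp
    qed
    also have "\<dots> = ennreal (a powr \<epsilon>) * ((\<integral>\<^sup>+y. ?f y \<partial>M) + (\<integral>\<^sup>+y. (\<Sum>m. ?g m y) \<partial>M))"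
      by (simp add: nn_integral_cmult nn_integral_add)
    also have "(\<integral>\<^sup>+y. (\<Sum>m. ?g m y) \<partial>M) = (\<Sum>m. ennreal ((3 / 2) ^ Suc m) * emeasure \<sigma> (B x r \<inter> ?U m))"
      by (simp add: nn_integral_suminf nn_integral_cmult emeasure_sigma)
    also have "\<dots> \<le> (\<Sum>m. ennreal (3 / 2 * (3 / 4) ^ m) * emeasure \<sigma> (B x r))"
    proof (intro suminf_le summableI)
      fix m
      have "ennreal ((3 / 2) ^ Suc m) * emeasure \<sigma> (B x r \<inter> ?U m)
        \<le> ennreal ((3 / 2) ^ Suc m) * (ennreal ((1 / 2) ^ m) * emeasure \<sigma> (B x r))"
        using decay[OF x, of m] by (intro mult_left_mono) (auto simp: a_def)
      also have "\<dots> = ennreal ((3 / 2) ^ Suc m * (1 / 2) ^ m) * emeasure \<sigma> (B x r)"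
        by (subst ennreal_mult) (auto simp: mult.assoc)
      also have "(3 / 2) ^ Suc m * (1 / 2) ^ m = (3 / 2 * (3 / 4) ^ m :: real)"
        by (simp add: power_mult_distrib[symmetric] mult.assoc)
      finally show "ennreal ((3 / 2) ^ Suc m) * emeasure \<sigma> (B x r \<inter> ?U m)
        \<le> ennreal (3 / 2 * (3 / 4) ^ m) * emeasure \<sigma> (B x r)" .
    qed
    also have "\<dots> = (\<Sum>m. ennreal (3 / 2 * (3 / 4) ^ m)) * emeasure \<sigma> (B x r)"
      by (rule ennreal_suminf_multc)
    also have "(\<Sum>m. ennreal (3 / 2 * (3 / 4) ^ m)) = ennreal 6"
    proof (rule suminf_ennreal_eq)
      show "(\<lambda>m. 3 / 2 * (3 / 4) ^ m) sums (6::real)"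
        using sums_mult[OF geometric_sums[of "3 / 4 :: real"], of "3 / 2"] by simp
    qed simp
    also have "(\<integral>\<^sup>+y. ?f y \<partial>M) = ennreal 1 * emeasure \<sigma> (B x r)" by (simp add: emeasure_sigma)
    also have "ennreal 1 * emeasure \<sigma> (B x r) + ennreal 6 * emeasure \<sigma> (B x r)
      = ennreal 7 * emeasure \<sigma> (B x r)"
      by (simp only: distrib_right[symmetric] ennreal_plus[symmetric]) simp
    also have "\<dots> \<le> ennreal 7 * ennreal (C * measure M (B x r) * a powr p)"
      unfolding a_def by (intro mult_left_mono reverse_hoelder x) auto
    also have "ennreal (a powr \<epsilon>) * \<dots> = ennreal (7 * C * measure M (B x r) * a powr (p + \<epsilon>))"
      using C by (simp only: ennreal_mult'[symmetric] powr_ge_zero) (simp add: powr_add mult_ac)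
    finally show ?thesis by (auto simp: a_def mult_left_mono add_left_mono)
  qed
  then show ?thesis using that \<epsilon> by blast
qed

end

text \<open>Local integrability only says that \<open>w\<close> is measurable on each ball; the balls of integer
  radius around one point exhaust the space.\<close>
lemma weight_borel_measurable:
  assumes "homogeneous_type_space M \<rho>" "weight M \<rho> w" "x \<in> space M"
  shows "w \<in> borel_measurable M"
proof -
  interpret homogeneous_type_space M \<rho> by fact
  show ?thesis
  proof (rule borel_measurable_LIMSEQ_real)
    show "(\<lambda>y. indicator (qball (space M) \<rho> x (real (Suc n))) y *\<^sub>R w y) \<in> borel_measurable M" for n
    proof (rule borel_measurable_integrable)
      have "0 < real (Suc n)" by simp
      then show "integrable M (\<lambda>y. indicator (qball (space M) \<rho> x (real (Suc n))) y *\<^sub>R w y)"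
        using assms(2,3) unfolding weight_def set_integrable_def by blast
    qed
    show "(\<lambda>n. indicator (qball (space M) \<rho> x (real (Suc n))) y *\<^sub>R w y) \<longlonglongrightarrow> w y" if y: "y \<in> space M" for y
    proof (rule tendsto_eventually)
      obtain N where N: "\<rho> x y < real N" using reals_Archimedean2 by blast
      show "\<forall>\<^sub>F n in sequentially. indicator (qball (space M) \<rho> x (real (Suc n))) y *\<^sub>R w y = w y"
        unfolding eventually_sequentially
        by (rule exI[of _ N]) (use N y in \<open>auto simp: qball_def split: split_indicator\<close>)
    qed
  qed
qed

lemma nn_integral_set_integrable:
  assumes "set_integrable M A f" "\<And>x. x \<in> space M \<Longrightarrow> 0 \<le> f x"
  shows "(\<integral>\<^sup>+x. ennreal (f x) * indicator A x \<partial>M) = ennreal (LINT x:A|M. f x)"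
proof -
  have "(\<integral>\<^sup>+x. ennreal (f x) * indicator A x \<partial>M) = (\<integral>\<^sup>+x. ennreal (indicator A x *\<^sub>R f x) \<partial>M)"
    by (intro nn_integral_cong) (auto split: split_indicator)
  also have "\<dots> = ennreal (LINT x:A|M. f x)"
    unfolding set_lebesgue_integral_def
    using assms by (intro nn_integral_eq_integral) (auto simp: set_integrable_def)
  finally show ?thesis .
qed

theorem theorem5p2:
  fixes M :: "'a measure" and \<rho> :: "'a \<Rightarrow> 'a \<Rightarrow> real" and w :: "'a \<Rightarrow> real" and p :: real
  assumes "homogeneous_type_space M \<rho>"
    and "borel_semiregular M \<rho>"
    and "1 < p"
    and "w \<in> reverse_hoelder_class M \<rho> p"
    and "doubling_weight M \<rho> w"
  shows "\<exists>\<epsilon>>0. w \<in> reverse_hoelder_class M \<rho> (p + \<epsilon>)"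
proof (cases "space M = {}")
  case True
  then show ?thesis
    using assms(4) by (intro exI[of _ 1]) (auto simp: reverse_hoelder_class_def)
next
  case False
  then obtain x0 where x0: "x0 \<in> space M" by blast
  interpret homogeneous_type_space M \<rho> by fact
  have wt: "weight M \<rho> w" using assms(5) by (simp add: doubling_weight_def)
  then have w0: "\<And>x. x \<in> space M \<Longrightarrow> 0 \<le> w x"
    and wint: "\<And>x r. x \<in> space M \<Longrightarrow> 0 < r \<Longrightarrow> set_integrable M (qball (space M) \<rho> x r) w"
    by (auto simp: weight_def)
  have wm[measurable]: "w \<in> borel_measurable M"
    using weight_borel_measurable[OF assms(1) wt x0] .
  from quasi_triangle obtain \<kappa>\<^sub>0 where k0:
    "\<forall>x\<in>space M. \<forall>y\<in>space M. \<forall>z\<in>space M. \<rho> x y \<le> \<kappa>\<^sub>0 * (\<rho> x z + \<rho> z y)"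
    by (elim exE conjE)
  define \<kappa> where "\<kappa> = max \<kappa>\<^sub>0 1"
  interpret homogeneous_constant_space M \<rho> \<kappa>
  proof unfold_locales
    show "1 \<le> \<kappa>" by (simp add: \<kappa>_def)
    fix x y z assume s: "x \<in> space M" "y \<in> space M" "z \<in> space M"
    have "\<rho> x y \<le> \<kappa>\<^sub>0 * (\<rho> x z + \<rho> z y)" using k0 s by simp
    also have "\<dots> \<le> \<kappa> * (\<rho> x z + \<rho> z y)"
      using nonneg[of x z] nonneg[of z y] s by (intro mult_right_mono) (auto simp: \<kappa>_def)
    finally show "\<rho> x y \<le> \<kappa> * (\<rho> x z + \<rho> z y)" .
  qed
  define \<nu> where "\<nu> = density M (\<lambda>x. ennreal (w x))"
  have em_nu: "emeasure \<nu> (B x r) = ennreal (LINT y : B x r | M. w y)" if "x \<in> space M" "0 < r" for x r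
    using qball_measurable[OF that] nn_integral_set_integrable[OF wint[OF that] w0]
    by (simp add: \<nu>_def emeasure_density)
  have int0: "0 \<le> (LINT y : B x r | M. f y)" if "\<And>y. y \<in> space M \<Longrightarrow> 0 \<le> f y" for x r and f :: "'a \<Rightarrow> real"
    unfolding set_lebesgue_integral_def using that by (intro Bochner_Integration.integral_nonneg) auto
  have me_nu: "measure \<nu> (B x r) = (LINT y : B x r | M. w y)" if "x \<in> space M" "0 < r" for x r
    using em_nu[OF that] int0[of w x r] w0 by (simp add: measure_def)
  define H where "H = \<kappa> * (1 + 3 * \<kappa>)"
  have H: "0 < H" using one_le_constant by (simp add: H_def)
  obtain D1 where D1: "1 \<le> D1"
    "\<And>x r. x \<in> space M \<Longrightarrow> 0 < r \<Longrightarrow> measure M (B x (H * r)) \<le> D1 * measure M (B x r)"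
    using dilated_qball_measure[OF H] by blast
  obtain c where "\<forall>x\<in>space M. \<forall>r>0. (LINT y : B x (2 * r) | M. w y) \<le> c * (LINT y : B x r | M. w y)"
    using assms(5) unfolding doubling_weight_def by (elim conjE exE)
  then have c: "measure \<nu> (B x (2 * r)) \<le> c * measure \<nu> (B x r)" if "x \<in> space M" "0 < r" for x r
    using that by (simp add: me_nu)
  have nu_mono: "measure \<nu> (B x r) \<le> measure \<nu> (B x s)" if "x \<in> space M" "0 < r" "r \<le> s" for x r s
    using that em_nu[of x s] qball_measurable
    by (intro measure_mono_fmeasurable qball_mono) (auto simp: fmeasurable_def \<nu>_def)
  obtain D2 where D2: "1 \<le> D2"
    "\<And>x r. x \<in> space M \<Longrightarrow> 0 < r \<Longrightarrow> measure \<nu> (B x (H * r)) \<le> D2 * measure \<nu> (B x r)"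
    by (rule iterated_doubling[where S = "space M" and m = "\<lambda>x r. measure \<nu> (B x r)" and c = c and H = H])
      (use nu_mono c H in auto)
  define D where "D = max D1 D2"
  obtain C0 where C0: "\<forall>x\<in>space M. \<forall>r>0. set_integrable M (B x r) (\<lambda>y. w y powr p) \<and>
      (1 / measure M (B x r) * (LINT y : B x r | M. w y powr p)) powr (1 / p)
        \<le> C0 * (1 / measure M (B x r) * (LINT y : B x r | M. w y))"
    using assms(4) unfolding reverse_hoelder_class_def Let_def by (elim CollectE conjE exE)
  \<comment> \<open>The sign of \<open>C0\<close> is unknown, as the means of \<open>w\<close> may all vanish.\<close>
  define C where "C = \<bar>C0\<bar> powr p"
  interpret reverse_hoelder_space M \<rho> \<kappa> w p C D \<nu> "density M (\<lambda>x. ennreal (w x powr p))"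
    "\<lambda>x r. measure \<nu> (B x r) / measure M (B x r)"
    unfolding \<nu>_def
  proof unfold_locales
    fix x r assume x: "x \<in> space M" "0 < (r :: real)"
    let ?m = "measure M (B x r)" and ?J = "LINT y : B x r | M. w y powr p"
    let ?a = "measure (density M (\<lambda>x. ennreal (w x))) (B x r) / ?m"
    have m: "0 < ?m" by (rule measure_qball_pos[OF x])
    have J: "0 \<le> ?J" by (rule int0) simp
    show "emeasure (density M (\<lambda>x. ennreal (w x))) (B x r) < \<infinity>"
      using em_nu[OF x] by (simp add: \<nu>_def)
    show "measure M (B x (\<kappa> * (1 + 3 * \<kappa>) * r)) \<le> D * ?m"
      unfolding H_def[symmetric]
      by (rule order_trans[OF D1(2)[OF x] mult_right_mono]) (simp_all add: D_def)
    show "measure (density M (\<lambda>x. ennreal (w x))) (B x (\<kappa> * (1 + 3 * \<kappa>) * r))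
        \<le> D * measure (density M (\<lambda>x. ennreal (w x))) (B x r)"
      unfolding H_def[symmetric] \<nu>_def[symmetric]
      by (rule order_trans[OF D2(2)[OF x] mult_right_mono]) (simp_all add: D_def)
    have "(1 / ?m * ?J) powr (1 / p) \<le> C0 * ?a" using C0 x me_nu[OF x] by (simp add: \<nu>_def)
    also have "\<dots> \<le> \<bar>C0\<bar> * ?a" by (intro mult_right_mono) auto
    finally have "((1 / ?m * ?J) powr (1 / p)) powr p \<le> (\<bar>C0\<bar> * ?a) powr p"
      using assms(3) by (intro powr_mono2) auto
    moreover have "((1 / ?m * ?J) powr (1 / p)) powr p = 1 / ?m * ?J"
      using assms(3) J m by (simp add: powr_powr)
    moreover have "(\<bar>C0\<bar> * ?a) powr p = C * ?a powr p" using m by (subst powr_mult) (simp_all add: C_def)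
    ultimately have "1 / ?m * ?J \<le> C * ?a powr p" by linarith
    then have "?m * (1 / ?m * ?J) \<le> ?m * (C * ?a powr p)" using m by (intro mult_left_mono) auto
    then have "?J \<le> C * ?m * ?a powr p" using m by (simp add: mult_ac)
    moreover have "emeasure (density M (\<lambda>x. ennreal (w x powr p))) (B x r) = ennreal ?J"
      using qball_measurable[OF x] nn_integral_set_integrable[of M "B x r" "\<lambda>y. w y powr p"] C0 x
      by (simp add: emeasure_density)
    ultimately show "emeasure (density M (\<lambda>x. ennreal (w x powr p))) (B x r) \<le> ennreal (C * ?m * ?a powr p)"
      by (simp add: ennreal_leI)
  qed (use assms w0 D1 in \<open>auto simp: C_def D_def\<close>)
  obtain \<epsilon> where \<epsilon>: "0 < \<epsilon>" "\<And>x r. x \<in> space M \<Longrightarrow> 0 < r \<Longrightarrow>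
    (\<integral>\<^sup>+y. ennreal (w y powr (p + \<epsilon>)) * indicator (B x r) y \<partial>M)
      \<le> ennreal (7 * C * measure M (B x r) * (measure \<nu> (B x r) / measure M (B x r)) powr (p + \<epsilon>))"
    using higher_integrability by blast
  define q where "q = p + \<epsilon>"
  have q: "0 < q" using assms(3) \<epsilon>(1) by (simp add: q_def)
  have "set_integrable M (B x r) (\<lambda>y. w y powr q) \<and>
      (1 / measure M (B x r) * (LINT y : B x r | M. w y powr q)) powr (1 / q)
        \<le> (7 * C) powr (1 / q) * (1 / measure M (B x r) * (LINT y : B x r | M. w y))"
    if x: "x \<in> space M" "0 < r" for x r
  proof
    let ?m = "measure M (B x r)" and ?J = "LINT y : B x r | M. w y powr q"
    let ?a = "measure \<nu> (B x r) / ?m"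
    have [measurable]: "B x r \<in> sets M" using x by (rule qball_measurable)
    have m: "0 < ?m" by (rule measure_qball_pos[OF x])
    have C: "0 \<le> C" by (simp add: C_def)
    have "(\<integral>\<^sup>+y. ennreal (norm (indicator (B x r) y *\<^sub>R w y powr q)) \<partial>M)
      = (\<integral>\<^sup>+y. ennreal (w y powr q) * indicator (B x r) y \<partial>M)"
      by (intro nn_integral_cong) (auto split: split_indicator)
    also have "\<dots> < \<infinity>" using \<epsilon>(2)[OF x] by (simp add: q_def le_less_trans[OF _ ennreal_less_top])
    finally show int: "set_integrable M (B x r) (\<lambda>y. w y powr q)"
      unfolding set_integrable_def by (intro integrableI_bounded) auto
    have "ennreal ?J \<le> ennreal (7 * C * ?m * ?a powr q)"
      using \<epsilon>(2)[OF x] nn_integral_set_integrable[OF int] by (simp add: q_def)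
    then have "?J \<le> 7 * C * ?m * ?a powr q" using C by (simp add: ennreal_le_iff)
    then have "1 / ?m * ?J \<le> 7 * C * ?a powr q" using m by (simp add: field_simps)
    then have "(1 / ?m * ?J) powr (1 / q) \<le> (7 * C * ?a powr q) powr (1 / q)"
      using q m int0[of "\<lambda>y. w y powr q" x r] by (intro powr_mono2) auto
    also have "\<dots> = (7 * C) powr (1 / q) * ?a"
      using C q by (simp add: powr_mult powr_powr)
    finally show "(1 / ?m * ?J) powr (1 / q) \<le> (7 * C) powr (1 / q) * (1 / ?m * (LINT y : B x r | M. w y))"
      using me_nu[OF x] by simp
  qed
  then have "w \<in> reverse_hoelder_class M \<rho> q"
    using wt unfolding reverse_hoelder_class_def Let_def by blast
  then show ?thesis using \<epsilon>(1) by (auto simp: q_def)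
qed

end
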